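(* Let $d\in\mathbb{N}$ and let $\mathcal{H}$ and $\mathcal{K}$ be weighted Besov spaces on $\mathbb{B}_d$ such that the pair $(\mathcal{H},\mathcal{K})$ satisfies the multiplier inclusion condition. Then there is a $c>0$ such that $$\|\Phi^R\|_{(\mathcal{H},\mathcal{K})}\le c\|\Phi^C\|_{(\mathcal{H},\mathcal{K})}$$ for all $\Phi=\{\varphi_1,\varphi_2,\dots\}\in M^C(\mathcal{H},\mathcal{K})$.
   Context: $\mathbb{B}_d$ is the open unit ball of $\mathbb{C}^d$ and $V$ is Lebesgue measure on $\mathbb{B}_d$ normalized so that $V(\mathbb{B}_d)=1$. A non-negative integrable function $\omega$ on $\mathbb{B}_d$ is an admissible weight if $L^2_a(\omega)=L^2(\omega\,dV)\cap\operatorname{Hol}(\mathbb{B}_d)$ is closed in $L^2(\omega\,dV)$ and point evaluations are bounded on $L^2_a(\omega)$ for each $z\in\mathbb{B}_d$. Let $R=\sum_{i=1}^dz_i\frac{\partial}{\partial z_i}$. For a positive integer $N$ let $B^N_\omega=\{f\in\operatorname{Hol}(\mathbb{B}_d):R^Nf\in L^2_a(\omega)\}$ with norm $\|f\|^2_{B^N_\omega}=\|\omega\|_{L^1(V)}|f(0)|^2+\int_{\mathbb{B}_d}|R^Nf|^2\omega\,dV$, and let $B^0_\omega=L^2_a(\omega)$. A weighted Besov space is a Hilbert space $\mathcal{H}$ of analytic functions on $\mathbb{B}_d$ (with bounded point evaluations) such that $\mathcal{H}=B^N_\omega$ with equivalence of norms for some admissible weight $\omega$ and some integer $N\ge 0$.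 For Hilbert spaces $\mathcal{H},\mathcal{K}$ of analytic functions on $\mathbb{B}_d$, $\operatorname{Mult}(\mathcal{H},\mathcal{K})=\{\varphi:\varphi\mathcal{H}\subseteq\mathcal{K}\}$. A sequence $\Phi=\{\varphi_1,\varphi_2,\dots\}\subseteq\operatorname{Mult}(\mathcal{H},\mathcal{K})$ defines $\Phi^C:h\mapsto(\varphi_1h,\varphi_2h,\dots)^T$ and $\Phi^R:(h_1,h_2,\dots)^T\mapsto\sum_i\varphi_ih_i$. $M^C(\mathcal{H},\mathcal{K})$ is the set of those $\Phi$ for which $\Phi^C:\mathcal{H}\to\bigoplus_{n=1}^\infty\mathcal{K}$ is bounded; $\|\Phi^C\|_{(\mathcal{H},\mathcal{K})}$ and $\|\Phi^R\|_{(\mathcal{H},\mathcal{K})}$ are the operator norms of $\Phi^C:\mathcal{H}\to\bigoplus_{n=1}^\infty\mathcal{K}$ and $\Phi^R:\bigoplus_{n=1}^\infty\mathcal{H}\to\mathcal{K}$. $M^C(\mathcal{H},\mathcal{K})$ is identified with $\operatorname{Mult}(\mathcal{H},\mathcal{K}(\ell_2))$, the functions $\Phi:\mathbb{B}_d\to\ell_2$ multiplying $\mathcal{H}$ into the $\ell_2$-valued space $\mathcal{K}(\ell_2)=\mathcal{K}\otimes\ell_2$, via components. The pair $(\mathcal{H},\mathcal{K})$ satisfies the multiplier inclusion condition if there are admissible weights $\omega,\tilde\omega$ and $N\in\mathbb{N}$ such that $\mathcal{H}=B^N_\omega$, $\mathcal{K}=B^N_{\tilde\omega}$ (equivalent norms)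 and $$\operatorname{Mult}(B^N_\omega,B^N_{\tilde\omega}(\ell_2))\subseteq\operatorname{Mult}(B^{N-1}_\omega,B^{N-1}_{\tilde\omega}(\ell_2))\subseteq\cdots\subseteq\operatorname{Mult}(B^0_\omega,B^0_{\tilde\omega}(\ell_2))$$ with continuous inclusions, i.e. for each $1\le n\le N$ there is $c>0$ with $\|\Phi\|_{\operatorname{Mult}(B^{n-1}_\omega,B^{n-1}_{\tilde\omega}(\ell_2))}\le c\|\Phi\|_{\operatorname{Mult}(B^n_\omega,B^n_{\tilde\omega}(\ell_2))}$ for all $\Phi\in\operatorname{Mult}(B^n_\omega,B^n_{\tilde\omega}(\ell_2))$. *)

theory Defs
  imports "HOL-Analysis.Analysis"
begin

text \<open>
  The dimension is \<open>d = CARD('d)\<close>. A function on the open unit ball of \<open>\<complex>\<^sup>d\<close> is represented by its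
  extension by \<open>0\<close> to the whole type, so that equality of elements of the spaces below is equality
  on the ball.
\<close>

type_synonym 'd bfun = "complex ^ 'd \<Rightarrow> complex"

abbreviation Bd :: "(complex ^ 'd::finite) set" where
  "Bd \<equiv> ball 0 1"

definition V :: "(complex ^ 'd::finite) measure" where
  "V = uniform_measure lebesgue Bd"

text \<open>Holomorphy in several variables is Frechet differentiability with complex-linear derivative.\<close>

definition Hol :: "'d::finite bfun set" where
  "Hol = {f. (\<forall>z\<in>Bd. \<exists>D. (f has_derivative D) (at z) \<and> (\<forall>c v. D (c *s v) = c * D v))
           \<and> (\<forall>z. z \<notin> Bd \<longrightarrow> f z = 0)}"

definition partial :: "'d::finite \<Rightarrow> 'd bfun \<Rightarrow> 'd bfun" where
  "partial i f z = deriv (\<lambda>w. f (\<chi> j. if j = i then w else z $ j)) (z $ i)"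

definition radial :: "'d::finite bfun \<Rightarrow> 'd bfun" where
  "radial f z = (if z \<in> Bd then \<Sum>i\<in>UNIV. z $ i * partial i f z else 0)"


section \<open>Weights and Besov spaces\<close>

definition L2 :: "(complex ^ 'd::finite \<Rightarrow> real) \<Rightarrow> 'd bfun set" where
  "L2 \<omega> = {f \<in> borel_measurable V. integrable V (\<lambda>z. (cmod (f z))\<^sup>2 * \<omega> z)}"

definition L2_norm :: "(complex ^ 'd::finite \<Rightarrow> real) \<Rightarrow> 'd bfun \<Rightarrow> real" where
  "L2_norm \<omega> f = sqrt (\<integral>z. (cmod (f z))\<^sup>2 * \<omega> z \<partial>V)"

definition L2a :: "(complex ^ 'd::finite \<Rightarrow> real) \<Rightarrow> 'd bfun set" where
  "L2a \<omega> = L2 \<omega> \<inter> Hol"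

text \<open>
  The condition on \<open>u\<close> and \<open>g\<close> says that \<open>L2a \<omega>\<close> is (sequentially) closed in the space
  \<open>L\<^sup>2(\<omega> dV)\<close>, whose elements are classes modulo equality \<open>\<omega> dV\<close>-almost everywhere.
\<close>

definition admissible_weight :: "(complex ^ 'd::finite \<Rightarrow> real) \<Rightarrow> bool" where
  "admissible_weight \<omega> \<longleftrightarrow>
     integrable V \<omega> \<and> (\<forall>z\<in>Bd. 0 \<le> \<omega> z) \<and>
     (\<forall>u g. (\<forall>n. u n \<in> L2a \<omega>) \<and> g \<in> L2 \<omega> \<and> (\<lambda>n. L2_norm \<omega> (\<lambda>z. u n z - g z)) \<longlonglongrightarrow> 0
        \<longrightarrow> (\<exists>f\<in>L2a \<omega>. AE z in density V (\<lambda>z. ennreal (\<omega> z)). f z = g z)) \<and>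
     (\<forall>z\<in>Bd. \<exists>C. \<forall>f\<in>L2a \<omega>. cmod (f z) \<le> C * L2_norm \<omega> f)"

record 'v nspace =
  carr :: "'v set"
  nrm :: "'v \<Rightarrow> real"

definition besov :: "nat \<Rightarrow> (complex ^ 'd::finite \<Rightarrow> real) \<Rightarrow> 'd bfun nspace" where
  "besov N \<omega> =
     (if N = 0 then \<lparr>carr = L2a \<omega>, nrm = L2_norm \<omega>\<rparr>
      else \<lparr>carr = {f \<in> Hol. (radial ^^ N) f \<in> L2a \<omega>},
            nrm = (\<lambda>f. sqrt ((\<integral>z. \<bar>\<omega> z\<bar> \<partial>V) * (cmod (f 0))\<^sup>2
                          + (\<integral>z. (cmod ((radial ^^ N) f z))\<^sup>2 * \<omega> z \<partial>V)))\<rparr>)"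

definition hilbert_space_of_analytic_functions :: "'d::finite bfun nspace \<Rightarrow> bool" where
  "hilbert_space_of_analytic_functions H \<longleftrightarrow>
     carr H \<subseteq> Hol \<and>
     (\<lambda>z. 0) \<in> carr H \<and>
     (\<forall>f\<in>carr H. \<forall>g\<in>carr H. (\<lambda>z. f z + g z) \<in> carr H) \<and>
     (\<forall>f\<in>carr H. \<forall>c. (\<lambda>z. c * f z) \<in> carr H) \<and>
     (\<exists>ip :: 'd bfun \<Rightarrow> 'd bfun \<Rightarrow> complex.
        (\<forall>f\<in>carr H. \<forall>g\<in>carr H. \<forall>h\<in>carr H. ip (\<lambda>z. f z + g z) h = ip f h + ip g h) \<and>
        (\<forall>f\<in>carr H. \<forall>g\<in>carr H. \<forall>c. ip (\<lambda>z. c * f z) g = c * ip f g) \<and>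
        (\<forall>f\<in>carr H. \<forall>g\<in>carr H. ip g f = cnj (ip f g)) \<and>
        (\<forall>f\<in>carr H. 0 \<le> Re (ip f f) \<and> (ip f f = 0 \<longrightarrow> f = (\<lambda>z. 0))
                     \<and> nrm H f = sqrt (Re (ip f f)))) \<and>
     (\<forall>u. (\<forall>n. u n \<in> carr H) \<and>
           (\<forall>e>0. \<exists>M. \<forall>m\<ge>M. \<forall>n\<ge>M. nrm H (\<lambda>z. u m z - u n z) < e)
        \<longrightarrow> (\<exists>f\<in>carr H. (\<lambda>n. nrm H (\<lambda>z. u n z - f z)) \<longlonglongrightarrow> 0)) \<and>
     (\<forall>z\<in>Bd. \<exists>C. \<forall>f\<in>carr H. cmod (f z) \<le> C * nrm H f)"

definition equiv_spaces :: "'v nspace \<Rightarrow> 'v nspace \<Rightarrow> bool" where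
  "equiv_spaces X Y \<longleftrightarrow>
     carr X = carr Y \<and>
     (\<exists>a>0. \<exists>b>0. \<forall>x\<in>carr X. a * nrm Y x \<le> nrm X x \<and> nrm X x \<le> b * nrm Y x)"

definition weighted_besov_space :: "'d::finite bfun nspace \<Rightarrow> bool" where
  "weighted_besov_space H \<longleftrightarrow>
     hilbert_space_of_analytic_functions H \<and>
     (\<exists>\<omega> N. admissible_weight \<omega> \<and> equiv_spaces H (besov N \<omega>))"


section \<open>Multipliers, columns and rows\<close>

text \<open>The countable Hilbert space direct sum; sequences are indexed from \<open>0\<close>.\<close>

definition l2_sum :: "'v nspace \<Rightarrow> (nat \<Rightarrow> 'v) nspace" where
  "l2_sum X = \<lparr>carr = {x. (\<forall>n. x n \<in> carr X) \<and> summable (\<lambda>n. (nrm X (x n))\<^sup>2)},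
             nrm = (\<lambda>x. sqrt (\<Sum>n. (nrm X (x n))\<^sup>2))\<rparr>"

text \<open>The operator norm is \<open>\<infinity>\<close> for an unbounded map; a zero vector contributes \<open>0\<close>.\<close>

definition op_norm :: "'v nspace \<Rightarrow> 'w nspace \<Rightarrow> ('v \<Rightarrow> 'w) \<Rightarrow> ennreal" where
  "op_norm X Y T = (SUP x\<in>carr X. ennreal (nrm Y (T x) / nrm X x))"

definition bounded_op :: "'v nspace \<Rightarrow> 'w nspace \<Rightarrow> ('v \<Rightarrow> 'w) \<Rightarrow> bool" where
  "bounded_op X Y T \<longleftrightarrow> T \<in> carr X \<rightarrow> carr Y \<and> op_norm X Y T < \<infinity>"

text \<open>
  Values of multipliers outside the ball are irrelevant, since the functions they multiply vanish
  there.
\<close>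

definition Mult :: "'d::finite bfun nspace \<Rightarrow> 'd bfun nspace \<Rightarrow> 'd bfun set" where
  "Mult H K = {\<phi>. \<forall>h\<in>carr H. (\<lambda>z. \<phi> z * h z) \<in> carr K}"

definition col_op :: "(nat \<Rightarrow> 'd::finite bfun) \<Rightarrow> 'd bfun \<Rightarrow> nat \<Rightarrow> 'd bfun" where
  "col_op \<Phi> h = (\<lambda>n z. \<Phi> n z * h z)"

definition row_op :: "(nat \<Rightarrow> 'd::finite bfun) \<Rightarrow> (nat \<Rightarrow> 'd bfun) \<Rightarrow> 'd bfun" where
  "row_op \<Phi> h = (\<lambda>z. \<Sum>n. \<Phi> n z * h n z)"

definition MC :: "'d::finite bfun nspace \<Rightarrow> 'd bfun nspace \<Rightarrow> (nat \<Rightarrow> 'd bfun) set" where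
  "MC H K = {\<Phi>. (\<forall>n. \<Phi> n \<in> Mult H K) \<and> bounded_op H (l2_sum K) (col_op \<Phi>)}"

text \<open>
  Multipliers of \<open>H\<close> into \<open>K(\<ell>\<^sub>2) = K \<otimes> \<ell>\<^sub>2\<close>. A function into \<open>\<ell>\<^sub>2\<close> is given by its sequence of
  component functions, and \<open>K(\<ell>\<^sub>2)\<close> is thereby \<open>l2_sum K\<close>.
\<close>

definition Mult_l2 :: "'d::finite bfun nspace \<Rightarrow> 'd bfun nspace \<Rightarrow> (nat \<Rightarrow> 'd bfun) set" where
  "Mult_l2 H K = {\<Phi>. (\<forall>z\<in>Bd. summable (\<lambda>n. (cmod (\<Phi> n z))\<^sup>2)) \<and>
                      (\<forall>h\<in>carr H. col_op \<Phi> h \<in> carr (l2_sum K))}"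

definition multiplier_inclusion_condition ::
    "'d::finite bfun nspace \<Rightarrow> 'd bfun nspace \<Rightarrow> bool" where
  "multiplier_inclusion_condition H K \<longleftrightarrow>
     (\<exists>\<omega> \<omega>' N. admissible_weight \<omega> \<and> admissible_weight \<omega>' \<and>
        equiv_spaces H (besov N \<omega>) \<and> equiv_spaces K (besov N \<omega>') \<and>
        (\<forall>n\<in>{1..N}.
           Mult_l2 (besov n \<omega>) (besov n \<omega>') \<subseteq> Mult_l2 (besov (n - 1) \<omega>) (besov (n - 1) \<omega>') \<and>
           (\<exists>c>0. \<forall>\<Phi>\<in>Mult_l2 (besov n \<omega>) (besov n \<omega>').
              op_norm (besov (n - 1) \<omega>) (l2_sum (besov (n - 1) \<omega>')) (col_op \<Phi>)
                \<le> ennreal c * op_norm (besov n \<omega>) (l2_sum (besov n \<omega>')) (col_op \<Phi>))))"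

end

theory Submission imports Defs "HOL-Complex_Analysis.Complex_Analysis" begin

text \<open>
  For \<open>N = 0\<close> the estimate is the pointwise Cauchy--Schwarz inequality in \<open>\<ell>\<^sub>2\<close>, integrated against the
  weight. In general, \<open>R^N (\<Sum>\<^sub>i \<phi>\<^sub>i h\<^sub>i)\<close> expands by the Leibniz rule into terms
  \<open>\<Sum>\<^sub>i (R^k \<phi>\<^sub>i) (R^(N-k) h\<^sub>i)\<close>, to which the same inequality applies once the column of the
  \<open>R^k \<phi>\<^sub>i\<close> is known to map the Besov space of order \<open>k\<close> boundedly into \<open>L\<^sup>2\<close>. This follows by
  induction on \<open>k\<close> from the hypothesis that the column of the \<open>\<phi>\<^sub>i\<close> multiplies the Besov spaces of
  every order \<open>n \<le> N\<close>.
\<close>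

section \<open>The radial derivative of a holomorphic function\<close>

text \<open>A column bound concerns one function at a time, whereas a row mixes all the entries
  \<open>h_i\<close>. Cauchy-Schwarz resolves this by decoupling the indices: it bounds a row by the
  sum over all pairs \<open>(i, j)\<close> of the squared moduli of
  \<open>R^k \<phi>_i * R^(N-k) h_j\<close>, and for fixed \<open>j\<close> the sum over
  \<open>i\<close> is a column applied to the single function \<open>R^(N-k) h_j\<close>. That
  function is only known to lie in the space of order \<open>k\<close>, which is why column bounds
  are needed in every order up to \<open>N\<close>. All these estimates are made for finite index
  sets with constants independent of the set, so that no infinite series is ever differentiated; the
  infinite row comes at the end from completeness of \<open>K\<close>. Two conventions leave traces
  throughout. Elements of the spaces vanish off the ball while multipliers are arbitrary there, so
  multipliers are cut off by \<open>indicator Bd\<close>, the constant function 1. A quotient by a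
  zero norm counts as 0 in \<open>op_norm\<close>, so definiteness of the Besov norms has to be
  proved before an operator norm yields an inequality for every vector.\<close>

abbreviation fderiv :: "'d::finite bfun \<Rightarrow> complex ^ 'd \<Rightarrow> complex ^ 'd \<Rightarrow> complex" where
  "fderiv f z \<equiv> frechet_derivative f (at z)"

section \<open>Complex scalar multiplication of vectors and basic facts on
  \<open>Hol\<close>\<close>

lemma norm_cmult_vec: "norm (c *s (v :: complex ^ 'd::finite)) = cmod c * norm v"
  by (simp add: norm_vec_def norm_mult L2_set_right_distrib)

lemma bounded_bilinear_smult_vec:
  "bounded_bilinear (\<lambda>c (v :: complex ^ 'd::finite). c *s v)"
proof
  show "\<exists>K. \<forall>c (v :: complex ^ 'd::finite). norm (c *s v) \<le> norm c * norm v * K"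
    by (rule exI[of _ 1]) (simp add: norm_cmult_vec)
qed (auto simp: vec_eq_iff algebra_simps)

lemmas bounded_linear_smult_left = bounded_bilinear.bounded_linear_left [OF bounded_bilinear_smult_vec]
lemmas bounded_linear_smult_right = bounded_bilinear.bounded_linear_right [OF bounded_bilinear_smult_vec]
lemmas continuous_on_smult_vec [continuous_intros] =
  bounded_bilinear.continuous_on [OF bounded_bilinear_smult_vec]

lemma Hol_has_derivative:
  assumes "f \<in> Hol" "z \<in> Bd"
  shows "(f has_derivative fderiv f z) (at z)"
  using assms unfolding Hol_def using frechet_derivative_at by blast

lemma fderiv_smult:
  assumes "f \<in> Hol" "z \<in> Bd"
  shows "fderiv f z (c *s v) = c * fderiv f z v"
  using assms unfolding Hol_def using frechet_derivative_at by fastforce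

lemma Hol_zero_outside: "f \<in> Hol \<Longrightarrow> z \<notin> Bd \<Longrightarrow> f z = 0"
  by (auto simp: Hol_def)

lemma Hol_continuous_on: "f \<in> Hol \<Longrightarrow> continuous_on Bd f"
  by (meson Hol_has_derivative continuous_at_imp_continuous_on has_derivative_continuous)

lemma HolI:
  assumes "\<And>z. z \<in> Bd \<Longrightarrow> (f has_derivative D z) (at z)"
    and "\<And>z c v. z \<in> Bd \<Longrightarrow> D z (c *s v) = c * D z v"
    and "\<And>z. z \<notin> Bd \<Longrightarrow> f z = 0"
  shows "f \<in> Hol"
  using assms unfolding Hol_def by blast

section \<open>Slices by complex lines and Cauchy's formula\<close>

text \<open>Complex linearity of the derivative is exactly what makes the restriction to a complex
  line holomorphic in one variable; the one-variable theory enters through such slices.\<close>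

lemma Hol_slice_has_field_derivative:
  assumes "f \<in> Hol" "w + \<zeta> *s v \<in> Bd"
  shows "((\<lambda>\<zeta>. f (w + \<zeta> *s v)) has_field_derivative fderiv f (w + \<zeta> *s v) v) (at \<zeta>)"
proof -
  have "((\<lambda>\<zeta>. w + \<zeta> *s v) has_derivative (\<lambda>\<zeta>. \<zeta> *s v)) (at \<zeta>)"
    using bounded_linear_imp_has_derivative[OF bounded_linear_smult_left]
    by (auto intro!: derivative_eq_intros)
  from has_derivative_compose[OF this Hol_has_derivative[OF assms]]
  have "((\<lambda>\<zeta>. f (w + \<zeta> *s v)) has_derivative (\<lambda>x. fderiv f (w + \<zeta> *s v) (x *s v))) (at \<zeta>)" .
  then show ?thesis
    unfolding has_field_derivative_def
    by (rule has_derivative_eq_rhs) (auto simp: fderiv_smult[OF assms] mult.commute)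
qed

text \<open>This is \<open>(2 * pi * \<i>)^-1\<close> times the contour integral of
  \<open>g u / (u - z)^2\<close>, with the circle parametrized by \<open>u = z + r * cis t\<close>.
  As an integral over a fixed real interval it is open to the theorems on continuity and
  differentiation of parameter integrals.\<close>

lemma deriv_eq_circle_integral:
  assumes "g holomorphic_on S" "open S" "cball z r \<subseteq> S" "0 < r"
  shows "deriv g z = integral {0..2 * pi} (\<lambda>t. g (z + r * cis t) / (r * cis t)) / (2 * pi)"
proof -
  have "((\<lambda>u. g u / (u - z) ^ Suc 1) has_contour_integral
          ((2 * pi * \<i>) / fact 1 * (deriv ^^ 1) g z)) (circlepath z r)"
    by (rule Cauchy_has_contour_integral_higher_derivative_circlepath)
      (use assms in \<open>auto intro: holomorphic_on_imp_continuous_on holomorphic_on_subset\<close>,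
       meson assms ball_subset_cball holomorphic_on_subset subset_trans)
  then have "((\<lambda>t. g (z + r * cis t) / (r * cis t) ^ 2 * r * \<i> * cis t) has_integral
      (2 * pi * \<i> * deriv g z)) {0..2 * pi}"
    unfolding circlepath_def
    by (subst (asm) has_contour_integral_part_circlepath_iff) (auto simp: numeral_2_eq_2)
  then have "((\<lambda>t. (1 / \<i>) * (g (z + r * cis t) / (r * cis t) ^ 2 * r * \<i> * cis t)) has_integral
      ((1 / \<i>) * (2 * pi * \<i> * deriv g z))) {0..2 * pi}"
    by (rule has_integral_mult_right)
  moreover have "(\<lambda>t. (1 / \<i>) * (g (z + r * cis t) / (r * cis t) ^ 2 * r * \<i> * cis t))
      = (\<lambda>t. g (z + r * cis t) / (r * cis t))"
    using assms(4) by (auto simp: power2_eq_square field_simps)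
  ultimately show ?thesis
    by (auto simp: integral_unique)
qed

lemma fderiv_eq_circle_integral:
  assumes f: "f \<in> Hol" and r: "0 < r" and sub: "\<And>\<zeta>. cmod \<zeta> \<le> r \<Longrightarrow> w + \<zeta> *s v \<in> Bd"
  shows "fderiv f w v =
    integral {0..2 * pi} (\<lambda>t. f (w + (r * cis t) *s v) / (r * cis t)) / (2 * pi)"
proof -
  define S where "S = {\<zeta>. w + \<zeta> *s v \<in> Bd}"
  have w: "w \<in> Bd"
    using sub[of 0] r by simp
  have "open S"
    unfolding S_def mem_ball_0 by (intro open_Collect_less continuous_intros)
  moreover have "(\<lambda>\<zeta>. f (w + \<zeta> *s v)) holomorphic_on S"
    unfolding S_def holomorphic_on_def field_differentiable_def
    by (blast intro: has_field_derivative_at_within Hol_slice_has_field_derivative[OF f])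
  moreover have "cball 0 r \<subseteq> S"
    unfolding S_def using sub by auto
  moreover have "deriv (\<lambda>\<zeta>. f (w + \<zeta> *s v)) 0 = fderiv f w v"
    using Hol_slice_has_field_derivative[OF f, of w 0 v] w by (simp add: DERIV_imp_deriv)
  ultimately show ?thesis
    using deriv_eq_circle_integral[of "\<lambda>\<zeta>. f (w + \<zeta> *s v)" S 0 r] r by simp
qed

text \<open>Membership in \<open>Hol\<close> asks for differentiability only. Near a given point one
  radius serves in Cauchy's formula for all centres, so the derivative is an integral of values of
  \<open>f\<close>, with an integrand jointly continuous in the centre and the angle.\<close>

lemma continuous_on_fderiv:
  fixes f :: "'d::finite bfun"
  assumes f: "f \<in> Hol"
  shows "continuous_on Bd (\<lambda>w. fderiv f w v)"
proof (rule continuous_at_imp_continuous_on, rule ballI)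
  fix w0 :: "complex ^ 'd" assume w0: "w0 \<in> Bd"
  \<comment> \<open>\<open>e\<close> is half the distance of \<open>w0\<close> from the sphere:
    displacing the centre by less than \<open>e\<close> and then going at most \<open>e\<close>
    along \<open>v\<close> stays in the ball. The 1 in the denominator of \<open>r\<close> covers
    \<open>v = 0\<close>.\<close>
  define e where "e = (1 - norm w0) / 2"
  define r where "r = e / (norm v + 1)"
  have e: "0 < e" using w0 by (simp add: e_def)
  then have r: "0 < r" by (simp add: r_def add_nonneg_pos)
  have sub: "w + \<zeta> *s v \<in> Bd" if "w \<in> ball w0 e" "cmod \<zeta> \<le> r" for w \<zeta>
  proof -
    have "cmod \<zeta> * norm v \<le> r * norm v" using that by (simp add: mult_right_mono)
    also have "\<dots> \<le> r * (norm v + 1)" using r by simp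
    also have "\<dots> = e" using r by (simp add: r_def add_nonneg_eq_0_iff)
    finally have "norm (\<zeta> *s v) \<le> e" by (simp add: norm_cmult_vec)
    moreover have "norm w < norm w0 + e"
      using that norm_triangle_ineq2[of w w0] by (simp add: dist_norm norm_minus_commute)
    moreover have "norm w0 + e + e = 1" by (simp add: e_def field_simps)
    ultimately show ?thesis
      using norm_triangle_ineq[of w "\<zeta> *s v"] by simp
  qed
  have "continuous_on (ball w0 e)
      (\<lambda>w. integral (cbox 0 (2 * pi)) (\<lambda>t. f (w + (r * cis t) *s v) / (r * cis t)))"
  proof (rule integral_continuous_on_param)
    have "continuous_on (ball w0 e \<times> cbox 0 (2 * pi)) (\<lambda>p. f (fst p + (r * cis (snd p)) *s v))"
      by (rule continuous_on_compose2[OF Hol_continuous_on[OF f]])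
        (use sub r in \<open>auto intro!: continuous_intros simp: norm_mult\<close>)
    then show "continuous_on (ball w0 e \<times> cbox 0 (2 * pi))
        (\<lambda>(w, t). f (w + (r * cis t) *s v) / (r * cis t))"
      unfolding case_prod_unfold using r by (intro continuous_intros) auto
  qed
  then have "continuous_on (ball w0 e)
      (\<lambda>w. integral {0..2 * pi} (\<lambda>t. f (w + (r * cis t) *s v) / (r * cis t)) / (2 * pi))"
    by (auto intro!: continuous_intros)
  then have "continuous_on (ball w0 e) (\<lambda>w. fderiv f w v)"
    by (rule continuous_on_eq) (rule fderiv_eq_circle_integral[OF f r sub, symmetric], auto)
  then show "continuous (at w0) (\<lambda>w. fderiv f w v)"
    using e by (simp add: continuous_on_eq_continuous_at)
qed

text \<open>Varying the coordinate \<open>i\<close> of \<open>z\<close> is a slice in direction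
  \<open>axis i 1\<close>, based at the point with that coordinate set to 0. So the partial
  derivatives are values of the derivative on the standard basis, and linearity assembles them at
  the vector \<open>z\<close> itself.\<close>

lemma radial_eq_fderiv:
  fixes f :: "'d::finite bfun"
  assumes f: "f \<in> Hol" and z: "z \<in> Bd"
  shows "radial f z = fderiv f z z"
proof -
  interpret D: bounded_linear "fderiv f z"
    using Hol_has_derivative[OF f z] has_derivative_bounded_linear by blast
  have "partial i f z = fderiv f z (axis i 1)" for i
  proof -
    have eq: "(\<lambda>w. f (\<chi> j. if j = i then w else z $ j)) = (\<lambda>w. f ((z - (z $ i) *s axis i 1) + w *s axis i 1))"
      by (intro ext arg_cong[of _ _ f]) (auto simp: vec_eq_iff axis_def)
    show ?thesis
      unfolding partial_def eq
      by (rule DERIV_imp_deriv)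
        (use Hol_slice_has_field_derivative[OF f, of "z - (z $ i) *s axis i 1" "z $ i" "axis i 1"] z in simp)
  qed
  then have "radial f z = (\<Sum>i\<in>UNIV. fderiv f z ((z $ i) *s axis i 1))"
    using z by (simp add: radial_def fderiv_smult[OF f z])
  also have "\<dots> = fderiv f z z"
    by (simp add: D.sum[symmetric] basis_expansion)
  finally show ?thesis .
qed

lemma radial_zero_outside [simp]: "z \<notin> Bd \<Longrightarrow> radial f z = 0"
  by (simp only: radial_def if_False)

lemma radial_origin [simp]: "radial f 0 = 0"
  by (simp add: radial_def)

text \<open>Differentiation under the integral sign in Cauchy's formula
  \<open>R f z = (2 \<pi>)\<^sup>-\<^sup>1 \<integral> f ((1 + r e\<^sup>i\<^sup>t) z) / (r e\<^sup>i\<^sup>t) dt\<close>.\<close>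
lemma radial_Hol:
  fixes f :: "'d::finite bfun"
  assumes f: "f \<in> Hol"
  shows "radial f \<in> Hol"
proof (unfold Hol_def, safe)
  fix z0 :: "complex ^ 'd" assume z0: "z0 \<in> Bd"
  \<comment> \<open>These radii are chosen so that \<open>(1 + r) * \<rho> < 1\<close>: all points
    \<open>\<mu> *s z\<close> with \<open>\<mu>\<close> within \<open>r\<close> of 1 then lie in the
    ball, uniformly for \<open>z\<close> in the neighbourhood of radius
    \<open>\<rho>\<close>.\<close>
  define \<rho> where "\<rho> = (1 + norm z0) / 2"
  define r where "r = (1 - \<rho>) / 2"
  have \<rho>: "norm z0 < \<rho>" "0 < \<rho>" "\<rho> < 1"
    using z0 norm_ge_zero[of z0] by (auto simp: \<rho>_def simp del: norm_ge_zero)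
  then have r: "0 < r" "r < 1" by (auto simp: r_def)
  have rr: "(1 + r) * \<rho> < 1"
  proof -
    have "(1 + r) * \<rho> = 1 - (1 - \<rho>) * (2 - \<rho>) / 2"
      by (simp add: r_def field_simps)
    then show ?thesis using \<rho> by (simp add: mult_pos_pos)
  qed
  let ?U = "ball (0 :: complex ^ 'd) \<rho>"
  have sub: "\<mu> *s z \<in> Bd" if "z \<in> ?U" "cmod (\<mu> - 1) \<le> r" for \<mu> z
  proof -
    have "cmod \<mu> \<le> 1 + r" using that(2) norm_triangle_ineq[of "\<mu> - 1" 1] by simp
    then have "cmod \<mu> * norm z \<le> (1 + r) * \<rho>" using that(1) r by (intro mult_mono) auto
    then show ?thesis using rr by (simp add: norm_cmult_vec)
  qed
  \<comment> \<open>In the radial derivative the direction is the base point, so the circle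
    \<open>z + (r * cis t) *s z\<close> is the scaling of \<open>z\<close> by
    \<open>l t\<close>.\<close>
  define l where "l t = 1 + r * cis t" for t
  have l: "cmod (l t - 1) \<le> r" for t
    using r by (simp add: l_def norm_mult)
  have UB: "?U \<subseteq> Bd" using \<rho> by auto
  have radial: "radial f z = integral {0..2 * pi} (\<lambda>t. f (l t *s z) / (r * cis t)) / (2 * pi)"
    if "z \<in> ?U" for z
  proof -
    have "radial f z = fderiv f z z" using that UB radial_eq_fderiv[OF f] by blast
    also have "\<dots> = integral {0..2 * pi} (\<lambda>t. f (z + (r * cis t) *s z) / (r * cis t)) / (2 * pi)"
    proof (rule fderiv_eq_circle_integral[OF f r(1)])
      fix \<zeta> assume "cmod \<zeta> \<le> r"
      then show "z + \<zeta> *s z \<in> Bd"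
        using sub[OF that, of "1 + \<zeta>"] by (simp add: vector_sadd_rdistrib)
    qed
    finally show ?thesis by (simp add: l_def vector_sadd_rdistrib)
  qed
  define Dv where "Dv x t v = l t / (r * cis t) * fderiv f (l t *s x) v" for x t v
  have Dv: "((\<lambda>x. f (l t *s x) / (r * cis t)) has_derivative Dv x t) (at x)" if "x \<in> ?U" for x t
  proof -
    have "((\<lambda>x. l t *s x) has_derivative (\<lambda>x. l t *s x)) (at x)"
      by (rule bounded_linear_imp_has_derivative[OF bounded_linear_smult_right])
    from has_derivative_compose[OF this Hol_has_derivative[OF f sub[OF that l]]]
    have "((\<lambda>x. f (l t *s x)) has_derivative (\<lambda>v. fderiv f (l t *s x) (l t *s v))) (at x)" .
    then have "((\<lambda>x. (1 / (r * cis t)) * f (l t *s x)) has_derivative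
        (\<lambda>v. (1 / (r * cis t)) * fderiv f (l t *s x) (l t *s v))) (at x)"
      by (rule has_derivative_mult_right)
    then show ?thesis
      by (simp add: Dv_def[abs_def] fderiv_smult[OF f sub[OF that l]])
  qed
  \<comment> \<open>The Leibniz rule for parameter integrals wants derivatives as bounded linear
    functions; \<open>Blinfun\<close> returns \<open>Dv x t\<close> only where that map is bounded
    linear, hence the restriction to the neighbourhood in the next fact.\<close>
  define D where "D x t = Blinfun (Dv x t)" for x t
  have D: "blinfun_apply (D x t) = Dv x t" if "x \<in> ?U" for x t
    unfolding D_def using Dv[OF that] bounded_linear_Blinfun_apply has_derivative_bounded_linear by blast
  \<comment> \<open>In finite dimension continuity in operator norm may be tested on single vectors,
    and there it is continuity of \<open>fderiv\<close>.\<close>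
  have cont: "continuous_on (?U \<times> cbox 0 (2 * pi)) (\<lambda>(x, t). D x t)"
  proof (rule continuous_on_blinfun_componentwise)
    fix i :: "complex ^ 'd"
    have "continuous_on (?U \<times> cbox 0 (2 * pi)) (\<lambda>p. fderiv f (l (snd p) *s fst p) i)"
      by (rule continuous_on_compose2[OF continuous_on_fderiv[OF f]])
        (use sub[OF _ l] in \<open>auto intro!: continuous_intros simp: l_def\<close>)
    then have "continuous_on (?U \<times> cbox 0 (2 * pi)) (\<lambda>p. Dv (fst p) (snd p) i)"
      unfolding Dv_def l_def using r by (intro continuous_intros) auto
    then show "continuous_on (?U \<times> cbox 0 (2 * pi)) (\<lambda>p. blinfun_apply (case p of (x, t) \<Rightarrow> D x t) i)"
      by (rule continuous_on_eq) (auto simp: D)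
  qed
  have contD: "continuous_on (cbox 0 (2 * pi)) (\<lambda>t. D z0 t)"
    by (rule continuous_on_compose2[OF cont, of _ "\<lambda>t. (z0, t)", simplified])
      (use \<rho> in \<open>auto intro!: continuous_intros\<close>)
  have "((\<lambda>x. integral (cbox 0 (2 * pi)) (\<lambda>t. f (l t *s x) / (of_real r * cis t))) has_derivative
      blinfun_apply (integral (cbox 0 (2 * pi)) (D z0))) (at z0 within ?U)"
  proof (rule leibniz_rule[OF _ _ cont])
    show "(\<lambda>t. f (l t *s x) / (of_real r * cis t)) integrable_on cbox 0 (2 * pi)" if "x \<in> ?U" for x
    proof (rule integrable_continuous)
      have "continuous_on (cbox 0 (2 * pi)) (\<lambda>t. f (l t *s x))"
        by (rule continuous_on_compose2[OF Hol_continuous_on[OF f]])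
          (use sub[OF that l] in \<open>auto intro!: continuous_intros simp: l_def\<close>)
      then show "continuous_on (cbox 0 (2 * pi)) (\<lambda>t. f (l t *s x) / (of_real r * cis t))"
        using r by (intro continuous_intros) auto
    qed
    show "((\<lambda>x. f (l t *s x) / (of_real r * cis t)) has_derivative blinfun_apply (D x t)) (at x within ?U)"
      if "x \<in> ?U" for x t
      using Dv[OF that] by (simp add: D[OF that] has_derivative_at_withinI)
  qed (use \<rho> in auto)
  then have "((\<lambda>x. integral {0..2 * pi} (\<lambda>t. f (l t *s x) / (of_real r * cis t))) has_derivative
      blinfun_apply (integral {0..2 * pi} (D z0))) (at z0)"
    using \<rho> by (subst (asm) at_within_open) auto
  then have "((\<lambda>x. integral {0..2 * pi} (\<lambda>t. f (l t *s x) / (of_real r * cis t)) / (2 * pi)) has_derivative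
      (\<lambda>v. blinfun_apply (integral {0..2 * pi} (D z0)) v / (2 * pi))) (at z0)"
    by (auto intro!: derivative_eq_intros)
  then have "(radial f has_derivative (\<lambda>v. blinfun_apply (integral {0..2 * pi} (D z0)) v / (2 * pi))) (at z0)"
    by (rule has_derivative_transform_within_open[of _ _ _ _ ?U]) (use \<rho> radial in auto)
  moreover have "blinfun_apply (integral {0..2 * pi} (D z0)) v = integral {0..2 * pi} (\<lambda>t. Dv z0 t v)" for v
  proof -
    have "integral {0..2 * pi} ((\<lambda>L. blinfun_apply L v) \<circ> D z0) = blinfun_apply (integral {0..2 * pi} (D z0)) v"
      using contD by (intro integral_linear integrable_continuous_real bounded_linear_intros) auto
    then show ?thesis using \<rho> by (simp add: o_def D)
  qed
  \<comment> \<open>Complex linearity of the derivative of \<open>radial f\<close> is inherited from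
    the integrand.\<close>
  moreover have "Dv z0 t (c *s v) = c * Dv z0 t v" for t c v
    using fderiv_smult[OF f sub[OF _ l, of z0]] \<rho> by (simp add: Dv_def)
  ultimately show "\<exists>D. (radial f has_derivative D) (at z0) \<and> (\<forall>c v. D (c *s v) = c * D v)"
    by (intro exI[of _ "\<lambda>v. blinfun_apply (integral {0..2 * pi} (D z0)) v / (2 * pi)"]) auto
qed simp

section \<open>The algebra of holomorphic functions and \<open>radial\<close> as a derivation on
  it\<close>

lemma Hol_add:
  assumes "f \<in> Hol" "g \<in> Hol"
  shows "(\<lambda>z. f z + g z) \<in> Hol"
  by (rule HolI[where D = "\<lambda>z v. fderiv f z v + fderiv g z v"])
    (auto intro!: has_derivative_add Hol_has_derivative assms
      simp: fderiv_smult assms Hol_zero_outside distrib_left)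

lemma Hol_mult:
  assumes "f \<in> Hol" "g \<in> Hol"
  shows "(\<lambda>z. f z * g z) \<in> Hol"
proof (rule HolI[where D = "\<lambda>z v. f z * fderiv g z v + fderiv f z v * g z"])
  show "((\<lambda>z. f z * g z) has_derivative (\<lambda>v. f z * fderiv g z v + fderiv f z v * g z)) (at z)"
    if "z \<in> Bd" for z
    using that by (intro has_derivative_mult Hol_has_derivative assms)
qed (simp_all add: fderiv_smult assms Hol_zero_outside algebra_simps)

lemma Hol_zero: "(\<lambda>z. 0) \<in> Hol"
  by (rule HolI[where D = "\<lambda>z v. 0"]) auto

lemma Hol_sum:
  assumes "\<And>i. i \<in> F \<Longrightarrow> f i \<in> Hol"
  shows "(\<lambda>z. \<Sum>i\<in>F. f i z) \<in> Hol"
  using assms by (induction F rule: infinite_finite_induct) (auto simp: Hol_zero Hol_add)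

text \<open>With extension by zero this is the constant function 1. It serves as a test function for
  columns and as the cut-off for multipliers.\<close>

lemma Hol_indicator: "indicator Bd \<in> Hol"
proof (rule HolI[where D = "\<lambda>z v. 0"])
  fix z :: "complex ^ 'd::finite" assume "z \<in> Bd"
  then show "((indicator Bd :: 'd bfun) has_derivative (\<lambda>v. 0)) (at z)"
    by (intro has_derivative_transform_within_open[OF has_derivative_const[of 1], where s = Bd]) auto
qed auto

lemma radial_eqI:
  assumes "f \<in> Hol" "z \<in> Bd" "(f has_derivative D) (at z)"
  shows "radial f z = D z"
  using radial_eq_fderiv[OF assms(1,2)] frechet_derivative_at[OF assms(3)] by simp

lemma radial_add:
  fixes f g :: "'d::finite bfun"
  assumes "f \<in> Hol" "g \<in> Hol"
  shows "radial (\<lambda>z. f z + g z) = (\<lambda>z. radial f z + radial g z)"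
proof
  fix z :: "complex ^ 'd"
  show "radial (\<lambda>z. f z + g z) z = radial f z + radial g z"
  proof (cases "z \<in> Bd")
    case True
    then have "radial (\<lambda>z. f z + g z) z = fderiv f z z + fderiv g z z"
      by (intro radial_eqI Hol_add assms has_derivative_add Hol_has_derivative)
    then show ?thesis using True assms by (simp add: radial_eq_fderiv)
  qed simp
qed

lemma radial_mult:
  fixes f g :: "'d::finite bfun"
  assumes "f \<in> Hol" "g \<in> Hol"
  shows "radial (\<lambda>z. f z * g z) = (\<lambda>z. radial f z * g z + f z * radial g z)"
proof
  fix z :: "complex ^ 'd"
  show "radial (\<lambda>z. f z * g z) z = radial f z * g z + f z * radial g z"
  proof (cases "z \<in> Bd")
    case True
    then have "radial (\<lambda>z. f z * g z) z = f z * fderiv g z z + fderiv f z z * g z"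
      by (intro radial_eqI Hol_mult assms has_derivative_mult Hol_has_derivative)
    then show ?thesis using True assms by (simp add: radial_eq_fderiv)
  qed simp
qed

lemma radial_zero: "radial (\<lambda>z. 0) = (\<lambda>z. 0)"
  by (simp add: radial_def partial_def fun_eq_iff)

lemma radial_indicator: "radial (indicator Bd) = (\<lambda>z. 0)"
proof
  fix z :: "complex ^ 'd::finite"
  show "radial (indicator Bd) z = 0"
  proof (cases "z \<in> Bd")
    case True
    then have "((indicator Bd :: 'd bfun) has_derivative (\<lambda>v. 0)) (at z)"
      by (intro has_derivative_transform_within_open[OF has_derivative_const[of 1], where s = Bd]) auto
    then show ?thesis using radial_eqI[OF Hol_indicator True] by blast
  qed simp
qed

section \<open>Iterated radial derivatives and the Leibniz rule\<close>

lemma radial_funpow_Hol: "f \<in> Hol \<Longrightarrow> (radial ^^ k) f \<in> Hol"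
  by (induction k) (auto intro: radial_Hol)

lemma radial_funpow_zero: "(radial ^^ k) (\<lambda>z. 0) = (\<lambda>z. 0)"
  by (induction k) (auto simp: radial_zero)

lemma radial_funpow_add:
  assumes "f \<in> Hol" "g \<in> Hol"
  shows "(radial ^^ k) (\<lambda>z. f z + g z) = (\<lambda>z. (radial ^^ k) f z + (radial ^^ k) g z)"
  using assms by (induction k) (auto simp: radial_add radial_funpow_Hol)

lemma radial_funpow_sum:
  assumes "\<And>i. i \<in> F \<Longrightarrow> f i \<in> Hol"
  shows "(radial ^^ k) (\<lambda>z. \<Sum>i\<in>F. f i z) = (\<lambda>z. \<Sum>i\<in>F. (radial ^^ k) (f i) z)"
  using assms
  by (induction F rule: infinite_finite_induct)
    (auto simp: radial_funpow_zero radial_funpow_add Hol_sum)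

text \<open>Pascal's rule for an arbitrary array \<open>a\<close>, indexed by the two orders of
  differentiation; it isolates the combinatorics of the Leibniz rule from the derivatives.\<close>

lemma sum_binomial_Suc:
  fixes a :: "nat \<Rightarrow> nat \<Rightarrow> 'a::comm_semiring_1"
  shows "(\<Sum>j\<le>Suc k. of_nat (Suc k choose j) * a j (Suc k - j)) =
    (\<Sum>j\<le>k. of_nat (k choose j) * a (Suc j) (k - j)) + (\<Sum>j\<le>k. of_nat (k choose j) * a j (Suc (k - j)))"
proof -
  \<comment> \<open>The added top term is harmless because \<open>k choose Suc k\<close> is
    0.\<close>
  have "(\<Sum>j\<le>k. of_nat (k choose j) * a j (Suc (k - j))) = (\<Sum>j\<le>Suc k. of_nat (k choose j) * a j (Suc k - j))"
    by (auto intro!: sum.cong simp: Suc_diff_le binomial_eq_0)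
  also have "\<dots> = a 0 (Suc k) + (\<Sum>j\<le>k. of_nat (k choose Suc j) * a (Suc j) (k - j))"
    by (subst sum.atMost_Suc_shift) simp
  finally show ?thesis
    by (subst sum.atMost_Suc_shift) (simp add: sum.distrib algebra_simps)
qed

text \<open>One derivative is peeled off on the inside, which leaves the two products
  \<open>radial f * g\<close> and \<open>f * radial g\<close>; the induction hypothesis is needed
  for both, hence the generalization over \<open>f\<close> and \<open>g\<close>.\<close>

lemma radial_funpow_mult:
  assumes "f \<in> Hol" "g \<in> Hol"
  shows "(radial ^^ k) (\<lambda>z. f z * g z) =
    (\<lambda>z. \<Sum>j\<le>k. of_nat (k choose j) * ((radial ^^ j) f z * (radial ^^ (k - j)) g z))"
  using assms
proof (induction k arbitrary: f g)
  case (Suc k)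
  have "(radial ^^ Suc k) (\<lambda>z. f z * g z) = (radial ^^ k) (\<lambda>z. radial f z * g z + f z * radial g z)"
    by (simp add: funpow_Suc_right radial_mult Suc.prems del: funpow.simps)
  also have "\<dots> = (\<lambda>z. (\<Sum>j\<le>k. of_nat (k choose j) * ((radial ^^ Suc j) f z * (radial ^^ (k - j)) g z))
      + (\<Sum>j\<le>k. of_nat (k choose j) * ((radial ^^ j) f z * (radial ^^ Suc (k - j)) g z)))"
    by (simp add: radial_funpow_add Hol_mult radial_Hol Suc funpow_Suc_right del: funpow.simps)
  also have "\<dots> = (\<lambda>z. \<Sum>j\<le>Suc k. of_nat (Suc k choose j) * ((radial ^^ j) f z * (radial ^^ (Suc k - j)) g z))"
    by (rule ext, subst sum_binomial_Suc) rule
  finally show ?case .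
qed simp

text \<open>Along the slice \<open>\<zeta> *s z\<close> the radial derivative is
  \<open>\<zeta>\<close> times the ordinary one, so the latter vanishes except possibly at 0, and
  continuity takes care of this one point.\<close>

lemma radial_eq_zero_imp_constant:
  fixes f :: "'d::finite bfun"
  assumes f: "f \<in> Hol" and 0: "radial f = (\<lambda>z. 0)" and z: "z \<in> Bd"
  shows "f z = f 0"
proof -
  let ?S = "cball 0 1 :: complex set"
  have S: "\<zeta> *s z \<in> Bd" if "\<zeta> \<in> ?S" for \<zeta>
    using that z mult_right_le_one_le[of "norm z" "cmod \<zeta>"]
    by (auto simp: norm_cmult_vec mult.commute)
  have der: "((\<lambda>\<zeta>. f (\<zeta> *s z)) has_field_derivative fderiv f (\<zeta> *s z) z) (at \<zeta>)" if "\<zeta> \<in> ?S" for \<zeta>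
    using Hol_slice_has_field_derivative[OF f, of 0 \<zeta> z] S[OF that] by simp
  have der0: "fderiv f (\<zeta> *s z) z = 0" if "\<zeta> \<in> ?S - {0}" for \<zeta>
  proof -
    have "\<zeta> * fderiv f (\<zeta> *s z) z = radial f (\<zeta> *s z)"
      using S that f by (simp add: radial_eq_fderiv fderiv_smult)
    then show ?thesis using that 0 by simp
  qed
  have "f (1 *s z) = f (0 *s z)"
  proof (rule has_derivative_zero_unique_strong_convex[of ?S "{0}" "\<lambda>\<zeta>. f (\<zeta> *s z)" 0 _ 1])
    show "continuous_on ?S (\<lambda>\<zeta>. f (\<zeta> *s z))"
      using der by (meson DERIV_isCont continuous_at_imp_continuous_on)
    show "((\<lambda>\<zeta>. f (\<zeta> *s z)) has_derivative (\<lambda>h. 0)) (at \<zeta> within ?S)" if "\<zeta> \<in> ?S - {0}" for \<zeta>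
      using der[of \<zeta>] der0[OF that] that
      by (auto simp: has_field_derivative_def lambda_zero intro: has_derivative_at_withinI)
  qed auto
  then show ?thesis by simp
qed

section \<open>Weighted Bergman and Besov spaces\<close>

lemma sets_V [measurable_cong, simp]: "sets V = sets lebesgue"
  by (simp add: V_def)

text \<open>Weights are only known to be nonnegative on the ball, where \<open>V\<close> is
  concentrated; signs of integrands are therefore handled almost everywhere.\<close>

lemma AE_V_I:
  assumes "\<And>z. z \<in> Bd \<Longrightarrow> P z"
  shows "AE z in V. P z"
  unfolding V_def by (rule AE_uniform_measureI) (use assms in auto)

lemma Hol_measurable_V:
  assumes "f \<in> Hol"
  shows "f \<in> borel_measurable V"
proof -
  have "(\<lambda>z. indicator Bd z *\<^sub>R f z) \<in> borel_measurable borel"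
    by (rule borel_measurable_continuous_on_indicator) (auto simp: Hol_continuous_on assms)
  also have "(\<lambda>z. indicator Bd z *\<^sub>R f z) = f"
    using assms by (auto simp: indicator_def Hol_zero_outside)
  finally have "f \<in> borel_measurable lebesgue"
    by (simp add: measurable_completion)
  then show ?thesis
    by (simp cong: measurable_cong_sets)
qed

lemma admissible_weight_measurable: "admissible_weight \<omega> \<Longrightarrow> \<omega> \<in> borel_measurable V"
  by (simp add: admissible_weight_def borel_measurable_integrable)

lemma admissible_weight_AE_nonneg: "admissible_weight \<omega> \<Longrightarrow> AE z in V. 0 \<le> \<omega> z"
  by (rule AE_V_I) (simp add: admissible_weight_def)

text \<open>The squared weighted norm with values in \<open>ennreal\<close>: it is meaningful before
  integrability is known, so that a finite bound itself proves membership in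
  \<open>L2a\<close>.\<close>

definition energy :: "(complex ^ 'd::finite \<Rightarrow> real) \<Rightarrow> 'd bfun \<Rightarrow> ennreal" where
  "energy \<omega> u = (\<integral>\<^sup>+ z. ennreal ((cmod (u z))\<^sup>2 * \<omega> z) \<partial>V)"

lemma L2_norm_nonneg:
  assumes "admissible_weight \<omega>"
  shows "0 \<le> L2_norm \<omega> f"
  unfolding L2_norm_def real_sqrt_ge_0_iff
  by (rule integral_nonneg_AE) (use admissible_weight_AE_nonneg[OF assms] in eventually_elim, simp)

lemma L2_norm_power2:
  assumes "admissible_weight \<omega>"
  shows "(L2_norm \<omega> f)\<^sup>2 = (\<integral>z. (cmod (f z))\<^sup>2 * \<omega> z \<partial>V)"
  unfolding L2_norm_def real_sqrt_pow2_iff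
  by (rule integral_nonneg_AE) (use admissible_weight_AE_nonneg[OF assms] in eventually_elim, simp)

lemma energy_eq_L2_norm:
  assumes "admissible_weight \<omega>" "f \<in> L2a \<omega>"
  shows "energy \<omega> f = ennreal ((L2_norm \<omega> f)\<^sup>2)"
  unfolding energy_def L2_norm_power2[OF assms(1)]
proof (rule nn_integral_eq_integral)
  show "AE z in V. 0 \<le> (cmod (f z))\<^sup>2 * \<omega> z"
    using admissible_weight_AE_nonneg[OF assms(1)] by eventually_elim simp
qed (use assms in \<open>simp add: L2a_def L2_def\<close>)

lemma L2aI_energy:
  assumes "admissible_weight \<omega>" "f \<in> Hol" "energy \<omega> f < \<infinity>"
  shows "f \<in> L2a \<omega>"
proof -
  note [measurable] = Hol_measurable_V[OF assms(2)] admissible_weight_measurable[OF assms(1)]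
  have "integrable V (\<lambda>z. (cmod (f z))\<^sup>2 * \<omega> z)"
  proof (rule integrableI_nonneg)
    show "AE z in V. 0 \<le> (cmod (f z))\<^sup>2 * \<omega> z"
      using admissible_weight_AE_nonneg[OF assms(1)] by eventually_elim simp
  qed (use assms in \<open>simp_all add: energy_def\<close>)
  then show ?thesis using assms by (simp add: L2a_def L2_def Hol_measurable_V)
qed

text \<open>The passage from pointwise estimates to energies: the Leibniz rule and Cauchy-Schwarz
  are applied at a single point and then integrated against the weight by this lemma.\<close>

lemma energy_le_sum:
  fixes u :: "'d::finite bfun"
  assumes \<omega>: "admissible_weight \<omega>" and F: "finite F" and c: "0 \<le> c"
    and v: "\<And>i. i \<in> F \<Longrightarrow> v i \<in> Hol"
    and le: "\<And>z. z \<in> Bd \<Longrightarrow> (cmod (u z))\<^sup>2 \<le> c * (\<Sum>i\<in>F. (cmod (v i z))\<^sup>2)"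
  shows "energy \<omega> u \<le> ennreal c * (\<Sum>i\<in>F. energy \<omega> (v i))"
proof -
  note [measurable] = admissible_weight_measurable[OF \<omega>]
  have [measurable]: "v i \<in> borel_measurable V" if "i \<in> F" for i
    using v[OF that] by (rule Hol_measurable_V)
  have "energy \<omega> u \<le> (\<integral>\<^sup>+ z. ennreal c * (\<Sum>i\<in>F. ennreal ((cmod (v i z))\<^sup>2 * \<omega> z)) \<partial>V)"
    unfolding energy_def
  proof (rule nn_integral_mono_AE, rule AE_V_I)
    fix z :: "complex ^ 'd" assume z: "z \<in> Bd"
    then have w: "0 \<le> \<omega> z" using \<omega> by (simp add: admissible_weight_def)
    have "(cmod (u z))\<^sup>2 * \<omega> z \<le> c * (\<Sum>i\<in>F. (cmod (v i z))\<^sup>2) * \<omega> z"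
      using le[OF z] w by (rule mult_right_mono)
    also have "\<dots> = c * (\<Sum>i\<in>F. (cmod (v i z))\<^sup>2 * \<omega> z)"
      by (simp add: sum_distrib_right mult.assoc)
    finally have "ennreal ((cmod (u z))\<^sup>2 * \<omega> z) \<le> ennreal (c * (\<Sum>i\<in>F. (cmod (v i z))\<^sup>2 * \<omega> z))"
      by (rule ennreal_leI)
    also have "\<dots> = ennreal c * (\<Sum>i\<in>F. ennreal ((cmod (v i z))\<^sup>2 * \<omega> z))"
      using w c by (subst sum_ennreal) (simp_all add: ennreal_mult')
    finally show "ennreal ((cmod (u z))\<^sup>2 * \<omega> z) \<le> ennreal c * (\<Sum>i\<in>F. ennreal ((cmod (v i z))\<^sup>2 * \<omega> z))" .
  qed
  also have "\<dots> = ennreal c * (\<Sum>i\<in>F. energy \<omega> (v i))"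
    unfolding energy_def by (subst nn_integral_cmult) (auto simp: nn_integral_sum)
  finally show ?thesis .
qed

section \<open>Besov norms: uniform formulas, contractivity of \<open>radial\<close>,
  definiteness\<close>

lemma carr_besov_iff: "f \<in> carr (besov n \<omega>) \<longleftrightarrow> f \<in> Hol \<and> (radial ^^ n) f \<in> L2a \<omega>"
  by (auto simp: besov_def L2a_def)

lemma nrm_besov_nonneg:
  assumes "admissible_weight \<omega>"
  shows "0 \<le> nrm (besov n \<omega>) f"
  using L2_norm_nonneg[OF assms] L2_norm_power2[OF assms, of "(radial ^^ n) f", symmetric]
  by (auto simp: besov_def)

lemma nrm_besov_power2:
  assumes "admissible_weight \<omega>"
  shows "(nrm (besov n \<omega>) f)\<^sup>2 =
    (if n = 0 then 0 else (\<integral>z. \<bar>\<omega> z\<bar> \<partial>V) * (cmod (f 0))\<^sup>2) + (L2_norm \<omega> ((radial ^^ n) f))\<^sup>2"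
  using L2_norm_power2[OF assms, of "(radial ^^ n) f", symmetric]
  by (auto simp: besov_def)

lemma energy_le_nrm_besov:
  assumes "admissible_weight \<omega>" "f \<in> carr (besov n \<omega>)"
  shows "energy \<omega> ((radial ^^ n) f) \<le> ennreal ((nrm (besov n \<omega>) f)\<^sup>2)"
  using assms by (auto simp: nrm_besov_power2 carr_besov_iff energy_eq_L2_norm intro!: ennreal_leI)

text \<open>The top derivatives coincide, as the orders add up. A radial derivative vanishes at the
  origin, so for \<open>j < k\<close> the left norm has no contribution from the value at 0, which
  gives the constant 1.\<close>

lemma radial_funpow_besov:
  assumes "admissible_weight \<omega>" "g \<in> carr (besov k \<omega>)" "j \<le> k"
  shows "(radial ^^ (k - j)) g \<in> carr (besov j \<omega>)"
    and "nrm (besov j \<omega>) ((radial ^^ (k - j)) g) \<le> nrm (besov k \<omega>) g"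
proof -
  have eq: "(radial ^^ j) ((radial ^^ (k - j)) g) = (radial ^^ k) g"
    using assms(3) by (simp flip: funpow_add[unfolded o_def, THEN fun_cong])
  then show "(radial ^^ (k - j)) g \<in> carr (besov j \<omega>)"
    using assms by (simp add: carr_besov_iff radial_funpow_Hol)
  have "(nrm (besov j \<omega>) ((radial ^^ (k - j)) g))\<^sup>2 \<le> (nrm (besov k \<omega>) g)\<^sup>2"
  proof (cases "j = k")
    case False
    then obtain m where "k - j = Suc m" using assms(3) by (metis Suc_diff_Suc le_neq_implies_less)
    then have "(radial ^^ (k - j)) g 0 = 0" by simp
    then show ?thesis using assms(3) by (simp add: nrm_besov_power2[OF assms(1)] eq)
  qed simp
  then show "nrm (besov j \<omega>) ((radial ^^ (k - j)) g) \<le> nrm (besov k \<omega>) g"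
    using nrm_besov_nonneg[OF assms(1)] power2_le_imp_le by blast
qed

text \<open>In order 0 this is integrability of the weight; in higher orders the radial derivative
  of the constant is 0.\<close>

lemma indicator_in_besov:
  assumes "admissible_weight \<omega>"
  shows "indicator Bd \<in> carr (besov n \<omega>)"
proof (cases n)
  case 0
  have "energy \<omega> (indicator Bd) \<le> (\<integral>\<^sup>+ z. ennreal (norm (\<omega> z)) \<partial>V)"
    unfolding energy_def by (rule nn_integral_mono) (auto simp: indicator_def intro!: ennreal_leI)
  also have "\<dots> < \<infinity>"
    using assms by (simp add: admissible_weight_def integrable_iff_bounded)
  finally show ?thesis
    using assms by (simp add: 0 carr_besov_iff Hol_indicator L2aI_energy)
next
  case (Suc m)
  then show ?thesis
    by (simp add: carr_besov_iff Hol_indicator funpow_Suc_right radial_indicator radial_funpow_zero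
        L2a_def L2_def Hol_zero del: funpow.simps)
qed

text \<open>A zero integral alone would say nothing where the weight vanishes; bounded point
  evaluations force every value to be 0.\<close>

lemma L2a_eq_zero:
  assumes "admissible_weight \<omega>" "f \<in> L2a \<omega>" "L2_norm \<omega> f = 0"
  shows "f = (\<lambda>z. 0)"
proof
  fix z
  show "f z = 0"
  proof (cases "z \<in> Bd")
    case True
    then obtain C where "\<forall>f\<in>L2a \<omega>. cmod (f z) \<le> C * L2_norm \<omega> f"
      using assms(1) unfolding admissible_weight_def by blast
    then show ?thesis using assms by force
  qed (use assms in \<open>simp add: L2a_def Hol_zero_outside\<close>)
qed

text \<open>Otherwise the constant 1 would have norm 0, against definiteness on
  \<open>L2a\<close>.\<close>

lemma admissible_weight_integral_pos:
  fixes \<omega> :: "complex ^ 'd::finite \<Rightarrow> real"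
  assumes "admissible_weight \<omega>"
  shows "0 < (\<integral>z. \<bar>\<omega> z\<bar> \<partial>V)"
proof (rule ccontr)
  assume "\<not> ?thesis"
  then have 0: "(\<integral>z. \<bar>\<omega> z\<bar> \<partial>V) = 0"
    using Bochner_Integration.integral_nonneg[of V "\<lambda>z. \<bar>\<omega> z\<bar>"] by fastforce
  have "(L2_norm \<omega> (indicator Bd))\<^sup>2 = (\<integral>z. \<bar>\<omega> z\<bar> \<partial>V)"
    unfolding L2_norm_power2[OF assms]
  proof (rule integral_cong_AE)
    show "AE z in V. (cmod (indicator Bd z))\<^sup>2 * \<omega> z = \<bar>\<omega> z\<bar>"
      by (rule AE_V_I) (use assms in \<open>simp add: admissible_weight_def\<close>)
  qed (use admissible_weight_measurable[OF assms] Hol_measurable_V[OF Hol_indicator] in measurable)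
  then have "(indicator Bd :: 'd bfun) = (\<lambda>z. 0)"
    using L2a_eq_zero[OF assms, of "indicator Bd"] indicator_in_besov[OF assms, of 0] 0
    by (simp add: carr_besov_iff)
  from fun_cong[OF this, of 0] show False by simp
qed

text \<open>By induction on the order: \<open>radial f\<close> has value 0 at the origin and one
  derivative less to kill, so it vanishes, and \<open>f\<close> is the constant
  \<open>f 0 = 0\<close>. Positivity of the total weight is what extracts \<open>f 0 = 0\<close>
  from the norm.\<close>

lemma besov_eq_zero:
  assumes \<omega>: "admissible_weight \<omega>" and f: "f \<in> carr (besov n \<omega>)" and 0: "nrm (besov n \<omega>) f = 0"
  shows "f = (\<lambda>z. 0)"
proof -
  have hol: "f \<in> Hol" using f by (simp add: carr_besov_iff)
  have L: "L2_norm \<omega> ((radial ^^ n) f) = 0" and f0: "n \<noteq> 0 \<Longrightarrow> f 0 = 0"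
    using nrm_besov_power2[OF \<omega>, of n f] 0 admissible_weight_integral_pos[OF \<omega>]
    by (auto simp: add_nonneg_eq_0_iff split: if_splits)
  then have "(radial ^^ n) f = (\<lambda>z. 0)"
    using L2a_eq_zero[OF \<omega>] f by (simp add: carr_besov_iff)
  with f0 hol show ?thesis
  proof (induction n arbitrary: f)
    case (Suc n)
    have "radial f = (\<lambda>z. 0)"
      by (rule Suc.IH) (use Suc.prems in \<open>auto simp: radial_Hol funpow_Suc_right simp del: funpow.simps\<close>)
    then have "f z = 0" if "z \<in> Bd" for z
      using radial_eq_zero_imp_constant[OF Suc.prems(2) _ that] Suc.prems(1) by auto
    then show ?case
      using Hol_zero_outside[OF Suc.prems(2)] by blast
  qed simp
qed

section \<open>Column and row estimates\<close>

text \<open>The binomial coefficients are at most \<open>2 ^ k\<close>, which squares to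
  \<open>4 ^ k\<close>; the factor \<open>k + 1\<close> counts the terms in Cauchy-Schwarz.\<close>

lemma cmod_binomial_sum_power2_le:
  "(cmod (\<Sum>j\<le>k. of_nat (k choose j) * x j))\<^sup>2 \<le> (real k + 1) * 4 ^ k * (\<Sum>j\<le>k. (cmod (x j))\<^sup>2)"
proof -
  have "cmod (\<Sum>j\<le>k. of_nat (k choose j) * x j) \<le> (\<Sum>j\<le>k. real (k choose j) * cmod (x j))"
    by (rule order_trans[OF norm_sum]) (simp add: norm_mult)
  also have "\<dots> \<le> (\<Sum>j\<le>k. 2 ^ k * cmod (x j))"
    using of_nat_mono[OF binomial_le_pow2, where 'a = real, of k]
    by (intro sum_mono mult_right_mono) simp_all
  finally have "(cmod (\<Sum>j\<le>k. of_nat (k choose j) * x j))\<^sup>2 \<le> (2 ^ k * (\<Sum>j\<le>k. cmod (x j)))\<^sup>2"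
    by (intro power_mono) (auto simp: sum_distrib_left)
  also have "\<dots> = 4 ^ k * (\<Sum>j\<le>k. cmod (x j))\<^sup>2"
    by (simp add: power_mult_distrib power2_eq_square flip: power_mult_distrib)
  also have "\<dots> \<le> 4 ^ k * ((\<Sum>j\<le>k. (cmod (x j))\<^sup>2) * card {..k})"
    by (intro mult_left_mono sum_squared_le_sum_of_squares) auto
  finally show ?thesis by (simp add: algebra_simps)
qed

text \<open>Cauchy-Schwarz with the product of the two sums multiplied out: each summand is the
  squared modulus of one product, whose energy can be taken, and the sum over \<open>i\<close> for
  fixed \<open>j\<close> has the shape of a column.\<close>

lemma cmod_sum_mult_power2_le:
  "(cmod (\<Sum>i\<in>F. a i * b i))\<^sup>2 \<le> (\<Sum>i\<in>F. \<Sum>j\<in>F. (cmod (a i * b j))\<^sup>2)"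
proof -
  have "cmod (\<Sum>i\<in>F. a i * b i) \<le> (\<Sum>i\<in>F. cmod (a i) * cmod (b i))"
    by (rule order_trans[OF norm_sum]) (simp add: norm_mult)
  then have "(cmod (\<Sum>i\<in>F. a i * b i))\<^sup>2 \<le> (\<Sum>i\<in>F. cmod (a i) * cmod (b i))\<^sup>2"
    by (intro power_mono) auto
  also have "\<dots> \<le> (\<Sum>i\<in>F. (cmod (a i))\<^sup>2) * (\<Sum>j\<in>F. (cmod (b j))\<^sup>2)"
    by (rule Cauchy_Schwarz_ineq_sum)
  finally show ?thesis by (simp add: sum_product norm_mult power_mult_distrib)
qed

section \<open>Finite sections of columns and rows\<close>

text \<open>The estimate that a column norm of at most \<open>A\<close> gives on the index set
  \<open>F\<close>. Stated between squares and without quotients, it also has content for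
  \<open>g\<close> of norm zero.\<close>

definition column_bound ::
    "nat \<Rightarrow> (complex ^ 'd::finite \<Rightarrow> real) \<Rightarrow> (complex ^ 'd \<Rightarrow> real) \<Rightarrow> real \<Rightarrow> nat set \<Rightarrow> (nat \<Rightarrow> 'd bfun) \<Rightarrow> bool" where
  "column_bound n \<omega> \<omega>' A F \<phi> \<longleftrightarrow>
     (\<forall>g\<in>carr (besov n \<omega>). (\<forall>i\<in>F. (\<lambda>z. \<phi> i z * g z) \<in> carr (besov n \<omega>')) \<and>
        (\<Sum>i\<in>F. (nrm (besov n \<omega>') (\<lambda>z. \<phi> i z * g z))\<^sup>2) \<le> A\<^sup>2 * (nrm (besov n \<omega>) g)\<^sup>2)"

lemma column_bound_energy:
  assumes "admissible_weight \<omega>'" "column_bound n \<omega> \<omega>' A F \<phi>" "g \<in> carr (besov n \<omega>)"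
  shows "(\<Sum>i\<in>F. energy \<omega>' ((radial ^^ n) (\<lambda>z. \<phi> i z * g z))) \<le> ennreal (A\<^sup>2 * (nrm (besov n \<omega>) g)\<^sup>2)"
proof -
  have "(\<Sum>i\<in>F. energy \<omega>' ((radial ^^ n) (\<lambda>z. \<phi> i z * g z))) \<le>
      (\<Sum>i\<in>F. ennreal ((nrm (besov n \<omega>') (\<lambda>z. \<phi> i z * g z))\<^sup>2))"
    using assms by (intro sum_mono energy_le_nrm_besov) (auto simp: column_bound_def)
  also have "\<dots> = ennreal (\<Sum>i\<in>F. (nrm (besov n \<omega>') (\<lambda>z. \<phi> i z * g z))\<^sup>2)"
    by (rule sum_ennreal) simp
  also have "\<dots> \<le> ennreal (A\<^sup>2 * (nrm (besov n \<omega>) g)\<^sup>2)"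
    using assms by (intro ennreal_leI) (auto simp: column_bound_def)
  finally show ?thesis .
qed

text \<open>The \<open>k\<close>-th derivatives form a bounded column from order \<open>k\<close>
  into the weighted \<open>L2\<close> space. \<open>C\<close> is chosen before \<open>A\<close>,
  \<open>F\<close>, \<open>\<phi>\<close> and \<open>g\<close>, so it depends on the order and the
  weights alone.\<close>

definition derivative_bound ::
    "nat \<Rightarrow> (complex ^ 'd::finite \<Rightarrow> real) \<Rightarrow> (complex ^ 'd \<Rightarrow> real) \<Rightarrow> real \<Rightarrow> bool" where
  "derivative_bound k \<omega> \<omega>' C \<longleftrightarrow> 0 \<le> C \<and>
     (\<forall>A F \<phi> g. (\<forall>i\<in>F. \<phi> i \<in> Hol) \<longrightarrow> (\<forall>n\<le>k. column_bound n \<omega> \<omega>' A F \<phi>) \<longrightarrow>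
        g \<in> carr (besov k \<omega>) \<longrightarrow>
        (\<Sum>i\<in>F. energy \<omega>' (\<lambda>z. (radial ^^ k) (\<phi> i) z * g z)) \<le> ennreal (C * A\<^sup>2 * (nrm (besov k \<omega>) g)\<^sup>2))"

lemma derivative_boundD:
  assumes "derivative_bound k \<omega> \<omega>' C" "\<forall>i\<in>F. \<phi> i \<in> Hol" "\<forall>n\<le>k. column_bound n \<omega> \<omega>' A F \<phi>"
    "g \<in> carr (besov k \<omega>)"
  shows "(\<Sum>i\<in>F. energy \<omega>' (\<lambda>z. (radial ^^ k) (\<phi> i) z * g z)) \<le> ennreal (C * A\<^sup>2 * (nrm (besov k \<omega>) g)\<^sup>2)"
  using assms unfolding derivative_bound_def by blast

text \<open>Solve the Leibniz rule for \<open>R^k (\<phi> g)\<close> for its term \<open>(R^k \<phi>) g\<close>; the other terms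
  \<open>(R^j \<phi>) (R^(k-j) g)\<close> with \<open>j < k\<close> are controlled by induction, since \<open>R^(k-j)\<close> maps the Besov
  space of order \<open>k\<close> contractively into that of order \<open>j\<close>.\<close>
lemma column_derivative_bound:
  fixes \<omega> \<omega>' :: "complex ^ 'd::finite \<Rightarrow> real"
  assumes \<omega>: "admissible_weight \<omega>" and \<omega>': "admissible_weight \<omega>'"
  shows "\<exists>C. derivative_bound k \<omega> \<omega>' C"
proof (induction k rule: less_induct)
  case (less k)
  then obtain C where C: "\<And>j. j < k \<Longrightarrow> derivative_bound j \<omega> \<omega>' (C j)"
    by metis
  then have C0: "0 \<le> C j" if "j < k" for j
    using that by (simp add: derivative_bound_def)
  define C' where "C' j = (if j < k then C j else 1)" for j
  define c where "c = (real k + 1) * 4 ^ k"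
  have C'0: "0 \<le> C' j" for j using C0 by (simp add: C'_def)
  have c0: "0 \<le> c" by (simp add: c_def)
  show ?case
    unfolding derivative_bound_def
  proof (intro exI[of _ "c * (\<Sum>j\<le>k. C' j)"] conjI allI impI)
    show "0 \<le> c * (\<Sum>j\<le>k. C' j)" using C'0 c0 by (simp add: sum_nonneg)
    fix A F and \<phi> :: "nat \<Rightarrow> 'd bfun" and g
    assume \<phi>: "\<forall>i\<in>F. \<phi> i \<in> Hol" and col: "\<forall>n\<le>k. column_bound n \<omega> \<omega>' A F \<phi>"
      and g: "g \<in> carr (besov k \<omega>)"
    have gH: "g \<in> Hol" using g by (simp add: carr_besov_iff)
    \<comment> \<open>The slots \<open>j < k\<close> hold the lower Leibniz terms. Slot
      \<open>k\<close> holds the whole derivative of the product, to which the column bound of order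
      \<open>k\<close> applies directly; hence the value 1 of \<open>C'\<close> there.\<close>
    define v where "v i j = (if j < k then (\<lambda>z. (radial ^^ j) (\<phi> i) z * (radial ^^ (k - j)) g z)
      else (radial ^^ k) (\<lambda>z. \<phi> i z * g z))" for i j
    have vj: "(\<Sum>i\<in>F. energy \<omega>' (v i j)) \<le> ennreal (C' j * (A\<^sup>2 * (nrm (besov k \<omega>) g)\<^sup>2))" if "j \<le> k" for j
    proof (cases "j < k")
      case True
      have "(\<Sum>i\<in>F. energy \<omega>' (v i j)) \<le> ennreal (C j * A\<^sup>2 * (nrm (besov j \<omega>) ((radial ^^ (k - j)) g))\<^sup>2)"
        unfolding v_def using True derivative_boundD[OF C[OF True] \<phi>] col radial_funpow_besov(1)[OF \<omega> g that] by auto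
      also have "\<dots> \<le> ennreal (C j * A\<^sup>2 * (nrm (besov k \<omega>) g)\<^sup>2)"
        using True C0 radial_funpow_besov(2)[OF \<omega> g that] nrm_besov_nonneg[OF \<omega>]
        by (intro ennreal_leI mult_left_mono power_mono) auto
      finally show ?thesis using True by (simp add: C'_def mult.assoc)
    next
      case False
      then show ?thesis
        using column_bound_energy[OF \<omega>' _ g] col by (simp add: v_def C'_def)
    qed
    have "energy \<omega>' (\<lambda>z. (radial ^^ k) (\<phi> i) z * g z) \<le> ennreal c * (\<Sum>j\<le>k. energy \<omega>' (v i j))"
      if "i \<in> F" for i
    proof (rule energy_le_sum[OF \<omega>' _ c0])
      show "v i j \<in> Hol" for j
        using \<phi> that by (auto simp: v_def intro!: radial_funpow_Hol Hol_mult gH)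
      fix z :: "complex ^ 'd"
      \<comment> \<open>Moving the lower terms to the other side only changes their signs, which
        disappear in the moduli; slot \<open>k\<close> enters with coefficient
        \<open>k choose k = 1\<close>.\<close>
      define x where "x j = (if j < k then - v i j z else v i j z)" for j
      have "(radial ^^ k) (\<lambda>z. \<phi> i z * g z) z =
          (\<Sum>j<k. of_nat (k choose j) * v i j z) + (radial ^^ k) (\<phi> i) z * g z"
        using \<phi> that by (subst radial_funpow_mult[OF _ gH])
          (auto simp: v_def lessThan_Suc_atMost[symmetric] intro!: sum.cong)
      then have "(radial ^^ k) (\<phi> i) z * g z = (\<Sum>j\<le>k. of_nat (k choose j) * x j)"
        by (simp add: x_def lessThan_Suc_atMost[symmetric] sum_negf v_def)
      then have "(cmod ((radial ^^ k) (\<phi> i) z * g z))\<^sup>2 \<le> c * (\<Sum>j\<le>k. (cmod (x j))\<^sup>2)"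
        unfolding c_def by (simp only: cmod_binomial_sum_power2_le)
      also have "(\<Sum>j\<le>k. (cmod (x j))\<^sup>2) = (\<Sum>j\<le>k. (cmod (v i j z))\<^sup>2)"
        by (intro sum.cong) (auto simp: x_def)
      finally show "(cmod ((radial ^^ k) (\<phi> i) z * g z))\<^sup>2 \<le> c * (\<Sum>j\<le>k. (cmod (v i j z))\<^sup>2)" .
    qed simp
    then have "(\<Sum>i\<in>F. energy \<omega>' (\<lambda>z. (radial ^^ k) (\<phi> i) z * g z)) \<le>
        (\<Sum>i\<in>F. ennreal c * (\<Sum>j\<le>k. energy \<omega>' (v i j)))"
      by (rule sum_mono)
    also have "\<dots> = ennreal c * (\<Sum>j\<le>k. \<Sum>i\<in>F. energy \<omega>' (v i j))"
      by (subst sum.swap) (simp add: sum_distrib_left)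
    also have "\<dots> \<le> ennreal c * (\<Sum>j\<le>k. ennreal (C' j * (A\<^sup>2 * (nrm (besov k \<omega>) g)\<^sup>2)))"
      by (intro mult_left_mono sum_mono vj) auto
    also have "\<dots> = ennreal c * ennreal ((\<Sum>j\<le>k. C' j) * (A\<^sup>2 * (nrm (besov k \<omega>) g)\<^sup>2))"
      using C'0 by (subst sum_ennreal) (simp_all add: sum_distrib_right)
    also have "\<dots> = ennreal (c * (\<Sum>j\<le>k. C' j) * A\<^sup>2 * (nrm (besov k \<omega>) g)\<^sup>2)"
      using c0 by (simp add: ennreal_mult'[symmetric] mult.assoc)
    finally show "(\<Sum>i\<in>F. energy \<omega>' (\<lambda>z. (radial ^^ k) (\<phi> i) z * g z)) \<le>
      ennreal (c * (\<Sum>j\<le>k. C' j) * A\<^sup>2 * (nrm (besov k \<omega>) g)\<^sup>2)" .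
  qed
qed

text \<open>Each order \<open>k\<close> of the Leibniz expansion is a row of its own; decoupling its
  indices lets the derivative bound of order \<open>k\<close> act on every
  \<open>R^(N-k) h_j\<close> separately, and the constants are summed over \<open>k\<close>.\<close>

lemma row_energy_bound:
  fixes \<omega> \<omega>' :: "complex ^ 'd::finite \<Rightarrow> real"
  assumes \<omega>: "admissible_weight \<omega>" and \<omega>': "admissible_weight \<omega>'"
  shows "\<exists>C\<ge>0. \<forall>A F \<phi> h. finite F \<longrightarrow> (\<forall>i\<in>F. \<phi> i \<in> Hol) \<longrightarrow> (\<forall>n\<le>N. column_bound n \<omega> \<omega>' A F \<phi>) \<longrightarrow>
    (\<forall>j\<in>F. h j \<in> carr (besov N \<omega>)) \<longrightarrow>
    energy \<omega>' ((radial ^^ N) (\<lambda>z. \<Sum>i\<in>F. \<phi> i z * h i z)) \<le>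
      ennreal (C * A\<^sup>2 * (\<Sum>j\<in>F. (nrm (besov N \<omega>) (h j))\<^sup>2))"
proof -
  obtain C where C: "\<And>k. derivative_bound k \<omega> \<omega>' (C k)"
    using column_derivative_bound[OF assms] by metis
  then have C0: "0 \<le> C k" for k
    by (simp add: derivative_bound_def)
  define c where "c = (real N + 1) * 4 ^ N"
  have c0: "0 \<le> c" by (simp add: c_def)
  show ?thesis
  proof (intro exI[of _ "c * (\<Sum>k\<le>N. C k)"] conjI allI impI)
    show "0 \<le> c * (\<Sum>k\<le>N. C k)" using C0 c0 by (simp add: sum_nonneg)
    fix A F and \<phi> h :: "nat \<Rightarrow> 'd bfun"
    assume F: "finite F" and \<phi>: "\<forall>i\<in>F. \<phi> i \<in> Hol" and col: "\<forall>n\<le>N. column_bound n \<omega> \<omega>' A F \<phi>"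
      and h: "\<forall>j\<in>F. h j \<in> carr (besov N \<omega>)"
    have hH: "h j \<in> Hol" if "j \<in> F" for j using h that by (simp add: carr_besov_iff)
    \<comment> \<open>The triples are: derivatives on the multiplier, entry of the vector, entry of
      the row.\<close>
    define v where "v = (\<lambda>(k, j, i) z. (radial ^^ k) (\<phi> i) z * (radial ^^ (N - k)) (h j) z)"
    have "energy \<omega>' ((radial ^^ N) (\<lambda>z. \<Sum>i\<in>F. \<phi> i z * h i z)) \<le>
        ennreal c * (\<Sum>p\<in>{..N} \<times> F \<times> F. energy \<omega>' (v p))"
    proof (rule energy_le_sum[OF \<omega>' _ c0])
      show "v p \<in> Hol" if "p \<in> {..N} \<times> F \<times> F" for p
        using that \<phi> by (auto simp: v_def intro!: Hol_mult radial_funpow_Hol hH)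
      fix z :: "complex ^ 'd"
      have "(radial ^^ N) (\<lambda>z. \<Sum>i\<in>F. \<phi> i z * h i z) z =
          (\<Sum>k\<le>N. of_nat (N choose k) * (\<Sum>i\<in>F. (radial ^^ k) (\<phi> i) z * (radial ^^ (N - k)) (h i) z))"
        using \<phi> by (simp add: radial_funpow_sum radial_funpow_mult Hol_mult hH sum_distrib_left sum.swap[of _ F])
      then have "(cmod ((radial ^^ N) (\<lambda>z. \<Sum>i\<in>F. \<phi> i z * h i z) z))\<^sup>2 \<le>
          c * (\<Sum>k\<le>N. (cmod (\<Sum>i\<in>F. (radial ^^ k) (\<phi> i) z * (radial ^^ (N - k)) (h i) z))\<^sup>2)"
        unfolding c_def by (simp only: cmod_binomial_sum_power2_le)
      also have "\<dots> \<le> c * (\<Sum>k\<le>N. \<Sum>i\<in>F. \<Sum>j\<in>F. (cmod ((radial ^^ k) (\<phi> i) z * (radial ^^ (N - k)) (h j) z))\<^sup>2)"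
        by (intro mult_left_mono sum_mono cmod_sum_mult_power2_le c0)
      also have "\<dots> = c * (\<Sum>p\<in>{..N} \<times> F \<times> F. (cmod (v p z))\<^sup>2)"
        by (subst sum.swap[of _ F]) (simp add: sum.cartesian_product v_def case_prod_unfold)
      finally show "(cmod ((radial ^^ N) (\<lambda>z. \<Sum>i\<in>F. \<phi> i z * h i z) z))\<^sup>2 \<le>
        c * (\<Sum>p\<in>{..N} \<times> F \<times> F. (cmod (v p z))\<^sup>2)" .
    qed (use F in simp)
    also have "\<dots> = ennreal c * (\<Sum>k\<le>N. \<Sum>j\<in>F. \<Sum>i\<in>F. energy \<omega>' (\<lambda>z. (radial ^^ k) (\<phi> i) z * (radial ^^ (N - k)) (h j) z))"
      by (simp add: sum.cartesian_product v_def case_prod_unfold)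
    also have "\<dots> \<le> ennreal c * (\<Sum>k\<le>N. \<Sum>j\<in>F. ennreal (C k * A\<^sup>2 * (nrm (besov N \<omega>) (h j))\<^sup>2))"
    \<comment> \<open>For fixed \<open>k\<close> and \<open>j\<close> the inner sum is the column of
      the derivatives applied to one function, which is of order \<open>k\<close> and has at most
      the norm of \<open>h j\<close>.\<close>
    proof (intro mult_left_mono sum_mono)
      fix k j assume k: "k \<in> {..N}" and j: "j \<in> F"
      have "(\<Sum>i\<in>F. energy \<omega>' (\<lambda>z. (radial ^^ k) (\<phi> i) z * (radial ^^ (N - k)) (h j) z))
          \<le> ennreal (C k * A\<^sup>2 * (nrm (besov k \<omega>) ((radial ^^ (N - k)) (h j)))\<^sup>2)"
        using k j h col by (intro derivative_boundD[OF C \<phi>] radial_funpow_besov(1)[OF \<omega>]) auto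
      also have "\<dots> \<le> ennreal (C k * A\<^sup>2 * (nrm (besov N \<omega>) (h j))\<^sup>2)"
        using k j h C0 nrm_besov_nonneg[OF \<omega>]
        by (intro ennreal_leI mult_left_mono power_mono radial_funpow_besov(2)[OF \<omega>]) auto
      finally show "(\<Sum>i\<in>F. energy \<omega>' (\<lambda>z. (radial ^^ k) (\<phi> i) z * (radial ^^ (N - k)) (h j) z))
          \<le> ennreal (C k * A\<^sup>2 * (nrm (besov N \<omega>) (h j))\<^sup>2)" .
    qed auto
    also have "\<dots> = ennreal c * ennreal (\<Sum>k\<le>N. \<Sum>j\<in>F. C k * A\<^sup>2 * (nrm (besov N \<omega>) (h j))\<^sup>2)"
      using C0 by (simp add: sum_ennreal sum_nonneg)
    also have "(\<Sum>k\<le>N. \<Sum>j\<in>F. C k * A\<^sup>2 * (nrm (besov N \<omega>) (h j))\<^sup>2) =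
        (\<Sum>k\<le>N. C k) * (A\<^sup>2 * (\<Sum>j\<in>F. (nrm (besov N \<omega>) (h j))\<^sup>2))"
      by (simp add: sum_distrib_left[symmetric] sum_distrib_right mult.assoc)
    also have "ennreal c * ennreal \<dots> =
        ennreal (c * (\<Sum>k\<le>N. C k) * A\<^sup>2 * (\<Sum>j\<in>F. (nrm (besov N \<omega>) (h j))\<^sup>2))"
      using c0 by (simp add: ennreal_mult'[symmetric] mult.assoc)
    finally show "energy \<omega>' ((radial ^^ N) (\<lambda>z. \<Sum>i\<in>F. \<phi> i z * h i z)) \<le>
        ennreal (c * (\<Sum>k\<le>N. C k) * A\<^sup>2 * (\<Sum>j\<in>F. (nrm (besov N \<omega>) (h j))\<^sup>2))" .
  qed
qed

text \<open>The energy controls the top derivative; for \<open>N > 0\<close> the value at the origin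
  remains. There Cauchy-Schwarz is used at the single point 0, and \<open>W\<close> times the
  squared modulus of \<open>\<phi> i 0 * h j 0\<close> is part of the squared norm of that product,
  so the column bound of order \<open>N\<close> suffices. This contributes the 1 in
  \<open>C + 1\<close>.\<close>

lemma finite_row_bound:
  fixes \<omega> \<omega>' :: "complex ^ 'd::finite \<Rightarrow> real"
  assumes \<omega>: "admissible_weight \<omega>" and \<omega>': "admissible_weight \<omega>'"
  shows "\<exists>C\<ge>0. \<forall>A F \<phi> h. finite F \<longrightarrow> (\<forall>i\<in>F. \<phi> i \<in> Hol) \<longrightarrow> (\<forall>n\<le>N. column_bound n \<omega> \<omega>' A F \<phi>) \<longrightarrow>
    (\<forall>j\<in>F. h j \<in> carr (besov N \<omega>)) \<longrightarrow>
    (\<lambda>z. \<Sum>i\<in>F. \<phi> i z * h i z) \<in> carr (besov N \<omega>') \<and>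
    (nrm (besov N \<omega>') (\<lambda>z. \<Sum>i\<in>F. \<phi> i z * h i z))\<^sup>2 \<le>
      C * A\<^sup>2 * (\<Sum>j\<in>F. (nrm (besov N \<omega>) (h j))\<^sup>2)"
proof -
  obtain C where C0: "0 \<le> C"
    and C: "\<forall>A F \<phi> h. finite F \<longrightarrow> (\<forall>i\<in>F. \<phi> i \<in> Hol) \<longrightarrow> (\<forall>n\<le>N. column_bound n \<omega> \<omega>' A F \<phi>) \<longrightarrow>
      (\<forall>j\<in>F. h j \<in> carr (besov N \<omega>)) \<longrightarrow>
      energy \<omega>' ((radial ^^ N) (\<lambda>z. \<Sum>i\<in>F. \<phi> i z * h i z)) \<le>
        ennreal (C * A\<^sup>2 * (\<Sum>j\<in>F. (nrm (besov N \<omega>) (h j))\<^sup>2))"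
    using row_energy_bound[OF assms, of N] by (elim exE conjE)
  show ?thesis
  proof (intro exI[of _ "C + 1"] conjI allI impI)
    show "0 \<le> C + 1" using C0 by simp
    fix A F and \<phi> h :: "nat \<Rightarrow> 'd bfun"
    assume F: "finite F" and \<phi>: "\<forall>i\<in>F. \<phi> i \<in> Hol" and col: "\<forall>n\<le>N. column_bound n \<omega> \<omega>' A F \<phi>"
      and h: "\<forall>j\<in>F. h j \<in> carr (besov N \<omega>)"
    let ?u = "\<lambda>z. \<Sum>i\<in>F. \<phi> i z * h i z"
    define S where "S = (\<Sum>j\<in>F. (nrm (besov N \<omega>) (h j))\<^sup>2)"
    have S0: "0 \<le> S" by (simp add: S_def sum_nonneg)
    have E: "energy \<omega>' ((radial ^^ N) ?u) \<le> ennreal (C * A\<^sup>2 * S)"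
      unfolding S_def using C F \<phi> col h by blast
    have uH: "?u \<in> Hol"
      using \<phi> h by (intro Hol_sum Hol_mult) (auto simp: carr_besov_iff)
    have L: "(radial ^^ N) ?u \<in> L2a \<omega>'"
      using E by (intro L2aI_energy[OF \<omega>'] radial_funpow_Hol uH) (auto intro: le_less_trans)
    then show "?u \<in> carr (besov N \<omega>')"
      using uH by (simp add: carr_besov_iff)
    have L2: "(L2_norm \<omega>' ((radial ^^ N) ?u))\<^sup>2 \<le> C * A\<^sup>2 * S"
      using E C0 S0 by (simp add: energy_eq_L2_norm[OF \<omega>' L])
    define W where "W = (\<integral>z. \<bar>\<omega>' z\<bar> \<partial>V)"
    have W0: "0 \<le> W" by (simp add: W_def)
    have O: "W * (cmod (?u 0))\<^sup>2 \<le> A\<^sup>2 * S" if "N \<noteq> 0"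
    proof -
      have "W * (cmod (?u 0))\<^sup>2 \<le> W * (\<Sum>i\<in>F. \<Sum>j\<in>F. (cmod (\<phi> i 0 * h j 0))\<^sup>2)"
        by (intro mult_left_mono cmod_sum_mult_power2_le W0)
      also have "\<dots> = (\<Sum>j\<in>F. \<Sum>i\<in>F. W * (cmod (\<phi> i 0 * h j 0))\<^sup>2)"
        by (subst sum.swap) (simp add: sum_distrib_left)
      also have "\<dots> \<le> (\<Sum>j\<in>F. \<Sum>i\<in>F. (nrm (besov N \<omega>') (\<lambda>z. \<phi> i z * h j z))\<^sup>2)"
        using that by (intro sum_mono) (simp add: nrm_besov_power2[OF \<omega>'] W_def)
      also have "\<dots> \<le> (\<Sum>j\<in>F. A\<^sup>2 * (nrm (besov N \<omega>) (h j))\<^sup>2)"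
        using col h by (intro sum_mono) (auto simp: column_bound_def)
      finally show ?thesis by (simp add: S_def sum_distrib_left)
    qed
    have "(nrm (besov N \<omega>') ?u)\<^sup>2 \<le> A\<^sup>2 * S + C * A\<^sup>2 * S"
      unfolding nrm_besov_power2[OF \<omega>'] W_def[symmetric]
      using L2 O S0 by (intro add_mono) auto
    then show "(nrm (besov N \<omega>') ?u)\<^sup>2 \<le> (C + 1) * A\<^sup>2 * S"
      by (simp add: algebra_simps)
  qed
qed

section \<open>Hilbert spaces of analytic functions and operator norms\<close>

lemma hilbert_space_uminus:
  assumes "hilbert_space_of_analytic_functions K" "f \<in> carr K"
  shows "(\<lambda>z. - f z) \<in> carr K"
proof -
  have "(\<lambda>z. (-1) * f z) \<in> carr K"
    using assms unfolding hilbert_space_of_analytic_functions_def by blast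
  then show ?thesis by simp
qed

lemma hilbert_space_add:
  assumes "hilbert_space_of_analytic_functions K" "f \<in> carr K" "g \<in> carr K"
  shows "(\<lambda>z. f z + g z) \<in> carr K"
  using assms unfolding hilbert_space_of_analytic_functions_def by blast

text \<open>Collects what the parallelogram law uses; the rules for the second argument come from
  those for the first by conjugate symmetry.\<close>

lemma hilbert_space_inner:
  assumes "hilbert_space_of_analytic_functions K"
  obtains ip :: "'d::finite bfun \<Rightarrow> 'd bfun \<Rightarrow> complex" where
    "\<And>f g h. f \<in> carr K \<Longrightarrow> g \<in> carr K \<Longrightarrow> h \<in> carr K \<Longrightarrow> ip (\<lambda>z. f z + g z) h = ip f h + ip g h"
    "\<And>f g h. f \<in> carr K \<Longrightarrow> g \<in> carr K \<Longrightarrow> h \<in> carr K \<Longrightarrow> ip h (\<lambda>z. f z + g z) = ip h f + ip h g"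
    "\<And>f g. f \<in> carr K \<Longrightarrow> g \<in> carr K \<Longrightarrow> ip (\<lambda>z. - f z) g = - ip f g"
    "\<And>f g. f \<in> carr K \<Longrightarrow> g \<in> carr K \<Longrightarrow> ip f (\<lambda>z. - g z) = - ip f g"
    "\<And>f. f \<in> carr K \<Longrightarrow> 0 \<le> Re (ip f f)"
    "\<And>f. f \<in> carr K \<Longrightarrow> nrm K f = sqrt (Re (ip f f))"
proof -
  obtain ip :: "'d bfun \<Rightarrow> 'd bfun \<Rightarrow> complex" where
    add: "\<forall>f\<in>carr K. \<forall>g\<in>carr K. \<forall>h\<in>carr K. ip (\<lambda>z. f z + g z) h = ip f h + ip g h"
    and cmult: "\<forall>f\<in>carr K. \<forall>g\<in>carr K. \<forall>c. ip (\<lambda>z. c * f z) g = c * ip f g"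
    and cnj: "\<forall>f\<in>carr K. \<forall>g\<in>carr K. ip g f = cnj (ip f g)"
    and pos: "\<forall>f\<in>carr K. 0 \<le> Re (ip f f) \<and> (ip f f = 0 \<longrightarrow> f = (\<lambda>z. 0)) \<and> nrm K f = sqrt (Re (ip f f))"
    using assms unfolding hilbert_space_of_analytic_functions_def by (elim exE conjE)
  have minus: "ip (\<lambda>z. - f z) g = - ip f g" if "f \<in> carr K" "g \<in> carr K" for f g
    using cmult[rule_format, OF that, of "-1"] by simp
  note add' = hilbert_space_add[OF assms] and minus' = hilbert_space_uminus[OF assms]
  show ?thesis
  proof (rule that[of ip])
    show "ip h (\<lambda>z. f z + g z) = ip h f + ip h g" if "f \<in> carr K" "g \<in> carr K" "h \<in> carr K" for f g h
    proof -
      have "ip h (\<lambda>z. f z + g z) = cnj (ip (\<lambda>z. f z + g z) h)"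
        using cnj add'[OF that(1,2)] that(3) by blast
      also have "\<dots> = cnj (ip f h) + cnj (ip g h)" using add that by simp
      also have "\<dots> = ip h f + ip h g" using cnj that by metis
      finally show ?thesis .
    qed
    show "ip f (\<lambda>z. - g z) = - ip f g" if "f \<in> carr K" "g \<in> carr K" for f g
    proof -
      have "ip f (\<lambda>z. - g z) = cnj (ip (\<lambda>z. - g z) f)"
        using cnj minus'[OF that(2)] that(1) by blast
      also have "\<dots> = - cnj (ip g f)" using minus that by simp
      also have "cnj (ip g f) = ip f g" using cnj that by metis
      finally show ?thesis .
    qed
  qed (use add minus pos in auto)
qed

lemma hilbert_space_nrm_nonneg:
  assumes "hilbert_space_of_analytic_functions K" "f \<in> carr K"
  shows "0 \<le> nrm K f"
  by (rule hilbert_space_inner[OF assms(1)]) (use assms(2) in simp)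

lemma hilbert_space_nrm_uminus:
  assumes "hilbert_space_of_analytic_functions K" "f \<in> carr K"
  shows "nrm K (\<lambda>z. - f z) = nrm K f"
  by (rule hilbert_space_inner[OF assms(1)])
    (use assms(2) hilbert_space_uminus[OF assms] in simp)

lemma hilbert_space_parallelogram:
  assumes K: "hilbert_space_of_analytic_functions K" and f: "f \<in> carr K" and g: "g \<in> carr K"
  shows "(nrm K (\<lambda>z. f z + g z))\<^sup>2 + (nrm K (\<lambda>z. f z + - g z))\<^sup>2 = 2 * (nrm K f)\<^sup>2 + 2 * (nrm K g)\<^sup>2"
proof -
  obtain ip where ip:
    "\<And>f g h. f \<in> carr K \<Longrightarrow> g \<in> carr K \<Longrightarrow> h \<in> carr K \<Longrightarrow> ip (\<lambda>z. f z + g z) h = ip f h + ip g h"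
    "\<And>f g h. f \<in> carr K \<Longrightarrow> g \<in> carr K \<Longrightarrow> h \<in> carr K \<Longrightarrow> ip h (\<lambda>z. f z + g z) = ip h f + ip h g"
    "\<And>f g. f \<in> carr K \<Longrightarrow> g \<in> carr K \<Longrightarrow> ip (\<lambda>z. - f z) g = - ip f g"
    "\<And>f g. f \<in> carr K \<Longrightarrow> g \<in> carr K \<Longrightarrow> ip f (\<lambda>z. - g z) = - ip f g"
    and pos: "\<And>f. f \<in> carr K \<Longrightarrow> 0 \<le> Re (ip f f)"
    and nrm: "\<And>f. f \<in> carr K \<Longrightarrow> nrm K f = sqrt (Re (ip f f))"
    by (rule hilbert_space_inner[OF K]) (rule that; simp)
  have sq: "(nrm K x)\<^sup>2 = Re (ip x x)" if "x \<in> carr K" for x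
    using nrm[OF that] pos[OF that] by simp
  note g' = hilbert_space_uminus[OF K g]
  show ?thesis
    using f g g' hilbert_space_add[OF K f g] hilbert_space_add[OF K f g']
    by (simp add: sq ip del: add_uminus_conv_diff)
qed

section \<open>Square-summable sequences and operator norms\<close>

lemma l2_sum_carr_iff: "x \<in> carr (l2_sum X) \<longleftrightarrow> (\<forall>n. x n \<in> carr X) \<and> summable (\<lambda>n. (nrm X (x n))\<^sup>2)"
  by (simp add: l2_sum_def)

lemma nrm_l2_sum_nonneg: "x \<in> carr (l2_sum X) \<Longrightarrow> 0 \<le> nrm (l2_sum X) x"
  by (simp add: l2_sum_def suminf_nonneg)

lemma nrm_l2_sum_power2: "x \<in> carr (l2_sum X) \<Longrightarrow> (nrm (l2_sum X) x)\<^sup>2 = (\<Sum>n. (nrm X (x n))\<^sup>2)"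
  by (simp add: l2_sum_def suminf_nonneg)

lemma sum_le_nrm_l2_sum:
  "x \<in> carr (l2_sum X) \<Longrightarrow> finite F \<Longrightarrow> (\<Sum>n\<in>F. (nrm X (x n))\<^sup>2) \<le> (nrm (l2_sum X) x)\<^sup>2"
  by (simp add: nrm_l2_sum_power2 l2_sum_carr_iff sum_le_suminf)

text \<open>Serves to carry columns from \<open>K\<close> over to its equivalent Besov
  space.\<close>

lemma l2_sum_mono:
  assumes x: "x \<in> carr (l2_sum X)" and Y: "\<And>n. x n \<in> carr Y" "\<And>n. 0 \<le> nrm Y (x n)"
    and le: "\<And>n. nrm Y (x n) \<le> c * nrm X (x n)" and c: "0 \<le> c"
  shows "x \<in> carr (l2_sum Y)" and "nrm (l2_sum Y) x \<le> c * nrm (l2_sum X) x"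
proof -
  have le2: "(nrm Y (x n))\<^sup>2 \<le> c\<^sup>2 * (nrm X (x n))\<^sup>2" for n
    using power_mono[OF le Y(2), of n 2] by (simp add: power_mult_distrib)
  have s: "summable (\<lambda>n. c\<^sup>2 * (nrm X (x n))\<^sup>2)"
    using x by (simp add: l2_sum_carr_iff summable_mult)
  have "summable (\<lambda>n. (nrm Y (x n))\<^sup>2)"
    by (rule summable_comparison_test'[OF s, of 0]) (use le2 in simp)
  then show xY: "x \<in> carr (l2_sum Y)" using Y by (simp add: l2_sum_carr_iff)
  have "(nrm (l2_sum Y) x)\<^sup>2 \<le> (\<Sum>n. c\<^sup>2 * (nrm X (x n))\<^sup>2)"
    unfolding nrm_l2_sum_power2[OF xY] using xY s le2 by (intro suminf_le) (auto simp: l2_sum_carr_iff)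
  also have "\<dots> = (c * nrm (l2_sum X) x)\<^sup>2"
    using x by (simp add: suminf_mult l2_sum_carr_iff nrm_l2_sum_power2 power_mult_distrib)
  finally show "nrm (l2_sum Y) x \<le> c * nrm (l2_sum X) x"
    using c nrm_l2_sum_nonneg[OF x] by (auto intro: power2_le_imp_le)
qed

text \<open>The quotient for a vector of norm 0 is 0 by convention, so nothing can be inferred about
  its image; for the same reason the converse below tests only vectors of positive norm.\<close>

lemma op_normD:
  assumes "op_norm X Y T \<le> ennreal A" "0 \<le> A" "x \<in> carr X" "0 < nrm X x"
  shows "nrm Y (T x) \<le> A * nrm X x"
proof -
  have "ennreal (nrm Y (T x) / nrm X x) \<le> op_norm X Y T"
    unfolding op_norm_def using assms(3) by (rule SUP_upper)
  also have "\<dots> \<le> ennreal A" by fact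
  finally show ?thesis using assms by (simp add: pos_divide_le_eq)
qed

lemma op_norm_leI:
  assumes "\<And>x. x \<in> carr X \<Longrightarrow> 0 < nrm X x \<Longrightarrow> nrm Y (T x) \<le> A * nrm X x"
    and "\<And>x. x \<in> carr X \<Longrightarrow> 0 \<le> nrm X x"
  shows "op_norm X Y T \<le> ennreal A"
  unfolding op_norm_def
proof (rule SUP_least)
  fix x assume x: "x \<in> carr X"
  show "ennreal (nrm Y (T x) / nrm X x) \<le> ennreal A"
  proof (cases "nrm X x = 0")
    case False
    then have "0 < nrm X x" using assms(2)[OF x] by simp
    with assms(1)[OF x] show ?thesis by (simp add: pos_divide_le_eq ennreal_leI)
  qed simp
qed

text \<open>The one-step inclusions are composed downwards from the top order, and their constants
  multiply.\<close>

lemma multiplier_chain_bound: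
  fixes X Y :: "nat \<Rightarrow> 'd::finite bfun nspace"
  assumes "\<forall>n\<in>{1..N}. Mult_l2 (X n) (Y n) \<subseteq> Mult_l2 (X (n - 1)) (Y (n - 1)) \<and>
    (\<exists>c>0. \<forall>\<Phi>\<in>Mult_l2 (X n) (Y n). op_norm (X (n - 1)) (l2_sum (Y (n - 1))) (col_op \<Phi>)
       \<le> ennreal c * op_norm (X n) (l2_sum (Y n)) (col_op \<Phi>))"
  shows "\<exists>P\<ge>0. \<forall>n\<le>N. \<forall>\<Phi>\<in>Mult_l2 (X N) (Y N). \<Phi> \<in> Mult_l2 (X n) (Y n) \<and>
    op_norm (X n) (l2_sum (Y n)) (col_op \<Phi>) \<le> ennreal P * op_norm (X N) (l2_sum (Y N)) (col_op \<Phi>)"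
  using assms
proof (induction N)
  case 0
  show ?case by (rule exI[of _ 1]) simp
next
  case (Suc N)
  obtain P where P0: "0 \<le> P" and P: "\<And>n \<Phi>. n \<le> N \<Longrightarrow> \<Phi> \<in> Mult_l2 (X N) (Y N) \<Longrightarrow> \<Phi> \<in> Mult_l2 (X n) (Y n) \<and>
      op_norm (X n) (l2_sum (Y n)) (col_op \<Phi>) \<le> ennreal P * op_norm (X N) (l2_sum (Y N)) (col_op \<Phi>)"
    using Suc by auto
  obtain c where c: "0 < c" and sub: "Mult_l2 (X (Suc N)) (Y (Suc N)) \<subseteq> Mult_l2 (X N) (Y N)"
    and le: "\<And>\<Phi>. \<Phi> \<in> Mult_l2 (X (Suc N)) (Y (Suc N)) \<Longrightarrow> op_norm (X N) (l2_sum (Y N)) (col_op \<Phi>)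
       \<le> ennreal c * op_norm (X (Suc N)) (l2_sum (Y (Suc N))) (col_op \<Phi>)"
    using Suc.prems[THEN bspec, of "Suc N"] by auto
  show ?case
  \<comment> \<open>The 1 is for the top order itself, where no inclusion is applied.\<close>
  proof (intro exI[of _ "max 1 (P * c)"] conjI allI impI ballI)
    fix n \<Phi> assume n: "n \<le> Suc N" and \<Phi>: "\<Phi> \<in> Mult_l2 (X (Suc N)) (Y (Suc N))"
    show "\<Phi> \<in> Mult_l2 (X n) (Y n)" using n \<Phi> sub P by (cases "n = Suc N") auto
    let ?o = "\<lambda>n. op_norm (X n) (l2_sum (Y n)) (col_op \<Phi>)"
    show "?o n \<le> ennreal (max 1 (P * c)) * ?o (Suc N)"
    proof (cases "n = Suc N")
      case True
      have "1 * ?o n \<le> ennreal (max 1 (P * c)) * ?o n"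
        by (rule mult_right_mono) (simp_all flip: ennreal_1 add: ennreal_leI)
      then show ?thesis using True by simp
    next
      case False
      then have "?o n \<le> ennreal P * ?o N" using n \<Phi> sub P by auto
      also have "\<dots> \<le> ennreal P * (ennreal c * ?o (Suc N))" by (intro mult_left_mono le[OF \<Phi>]) simp
      also have "\<dots> = ennreal (P * c) * ?o (Suc N)" using P0 by (simp add: ennreal_mult' mult.assoc)
      also have "\<dots> \<le> ennreal (max 1 (P * c)) * ?o (Suc N)" by (intro mult_right_mono ennreal_leI) auto
      finally show ?thesis .
    qed
  qed simp
qed

text \<open>By completeness of \<open>K\<close>, a bound on finite rows passes to infinite ones; the factor \<open>2\<close> comes
  from using the parallelogram law in place of the triangle inequality.\<close>
lemma row_op_bound:
  fixes H K :: "'d::finite bfun nspace"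
  assumes H: "hilbert_space_of_analytic_functions H" and K: "hilbert_space_of_analytic_functions K"
    and B0: "0 \<le> B" and h: "h \<in> carr (l2_sum H)"
    and fin: "\<And>F. finite F \<Longrightarrow> (\<lambda>z. \<Sum>i\<in>F. \<Phi> i z * h i z) \<in> carr K"
    and le: "\<And>F. finite F \<Longrightarrow> (nrm K (\<lambda>z. \<Sum>i\<in>F. \<Phi> i z * h i z))\<^sup>2 \<le> B * (\<Sum>i\<in>F. (nrm H (h i))\<^sup>2)"
  shows "\<forall>z\<in>Bd. summable (\<lambda>n. \<Phi> n z * h n z)" and "row_op \<Phi> h \<in> carr K"
    and "(nrm K (row_op \<Phi> h))\<^sup>2 \<le> 2 * B * (nrm (l2_sum H) h)\<^sup>2"
proof -
  define s where "s n = (\<lambda>z. \<Sum>i<n. \<Phi> i z * h i z)" for n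
  have s: "s n \<in> carr K" for n unfolding s_def by (rule fin) simp
  have diff: "(\<lambda>z. s m z - s n z) \<in> carr K" "(nrm K (\<lambda>z. s m z - s n z))\<^sup>2 \<le> B * (\<Sum>i=n..<m. (nrm H (h i))\<^sup>2)"
    if "n \<le> m" for m n
  proof -
    have "(\<lambda>z. s m z - s n z) = (\<lambda>z. \<Sum>i=n..<m. \<Phi> i z * h i z)"
      unfolding s_def lessThan_atLeast0 using that by (simp add: sum_diff_nat_ivl)
    then show "(\<lambda>z. s m z - s n z) \<in> carr K" "(nrm K (\<lambda>z. s m z - s n z))\<^sup>2 \<le> B * (\<Sum>i=n..<m. (nrm H (h i))\<^sup>2)"
      using fin le by simp_all
  qed
  have "\<exists>M. \<forall>m\<ge>M. \<forall>n\<ge>M. nrm K (\<lambda>z. s m z - s n z) < e" if e: "0 < e" for e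
  proof -
    \<comment> \<open>With \<open>B + 1\<close> in place of \<open>B\<close> the tail estimate stays
      strict and covers \<open>B = 0\<close>.\<close>
    have "0 < e\<^sup>2 / (B + 1)" using e B0 by simp
    moreover have "summable (\<lambda>n. (nrm H (h n))\<^sup>2)" using h by (simp add: l2_sum_carr_iff)
    ultimately obtain M where M: "\<And>m n. M \<le> m \<Longrightarrow> (\<Sum>i=m..<n. (nrm H (h i))\<^sup>2) < e\<^sup>2 / (B + 1)"
      unfolding summable_Cauchy by (metis abs_less_iff real_norm_def)
    have *: "nrm K (\<lambda>z. s m z - s n z) < e" if "M \<le> n" "n \<le> m" for m n
    proof -
      have "(nrm K (\<lambda>z. s m z - s n z))\<^sup>2 \<le> B * (\<Sum>i=n..<m. (nrm H (h i))\<^sup>2)" using diff that by blast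
      also have "\<dots> \<le> B * (e\<^sup>2 / (B + 1))" using M[OF that(1), of m] B0 by (intro mult_left_mono) auto
      also have "\<dots> < e\<^sup>2" using e B0 by (simp add: field_simps)
      finally show ?thesis using e by (simp add: power2_less_imp_less)
    qed
    have "nrm K (\<lambda>z. s m z - s n z) < e" if "M \<le> m" "M \<le> n" for m n
    proof (cases "n \<le> m")
      case False
      then have "nrm K (\<lambda>z. s m z - s n z) = nrm K (\<lambda>z. s n z - s m z)"
        using hilbert_space_nrm_uminus[OF K diff(1)[of m n]] by simp
      then show ?thesis using * that False by simp
    qed (use * that in blast)
    then show ?thesis by blast
  qed
  moreover have "\<forall>u. (\<forall>n. u n \<in> carr K) \<and>
           (\<forall>e>0. \<exists>M. \<forall>m\<ge>M. \<forall>n\<ge>M. nrm K (\<lambda>z. u m z - u n z) < e)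
        \<longrightarrow> (\<exists>f\<in>carr K. (\<lambda>n. nrm K (\<lambda>z. u n z - f z)) \<longlonglongrightarrow> 0)"
    using K unfolding hilbert_space_of_analytic_functions_def by (elim conjE)
  ultimately obtain f where f: "f \<in> carr K" and lim: "(\<lambda>n. nrm K (\<lambda>z. s n z - f z)) \<longlonglongrightarrow> 0"
    using s by blast
  have sf: "(\<lambda>z. s n z - f z) \<in> carr K" for n
    using hilbert_space_add[OF K s hilbert_space_uminus[OF K f]] by simp
  \<comment> \<open>Bounded point evaluations turn norm convergence into pointwise convergence,
    which identifies the abstract limit \<open>f\<close> with the series defining
    \<open>row_op\<close>.\<close>
  have sums: "(\<lambda>n. \<Phi> n z * h n z) sums f z" if z: "z \<in> Bd" for z
  proof -
    obtain C where C: "\<forall>f\<in>carr K. cmod (f z) \<le> C * nrm K f"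
      using K z unfolding hilbert_space_of_analytic_functions_def by blast
    have "\<forall>n. norm (s n z - f z) \<le> C * nrm K (\<lambda>z. s n z - f z)"
      using bspec[OF C sf] by simp
    then have "(\<lambda>n. s n z - f z) \<longlonglongrightarrow> 0"
      by (rule Lim_null_comparison[OF always_eventually tendsto_mult_right_zero[OF lim]])
    then show ?thesis unfolding sums_def s_def by (simp add: LIM_zero_iff)
  qed
  then show "\<forall>z\<in>Bd. summable (\<lambda>n. \<Phi> n z * h n z)" by (blast intro: sums_summable)
  have out: "u z = 0" if "hilbert_space_of_analytic_functions X" "u \<in> carr X" "z \<notin> Bd" for u z X
    using that Hol_zero_outside unfolding hilbert_space_of_analytic_functions_def by blast
  have row: "row_op \<Phi> h = f"
  proof
    fix z
    show "row_op \<Phi> h z = f z"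
    proof (cases "z \<in> Bd")
      case False
      then have "h n z = 0" for n using out[OF H, of "h n"] h by (simp add: l2_sum_carr_iff)
      then show ?thesis using out[OF K f False] by (simp add: row_op_def)
    qed (simp add: row_op_def sums_unique[OF sums, symmetric])
  qed
  then show "row_op \<Phi> h \<in> carr K" using f by simp
  \<comment> \<open>Here \<open>f\<close> is written as \<open>s n - (s n - f)\<close> and the other
    square in the parallelogram law is dropped; the error term vanishes as \<open>n\<close>
    grows.\<close>
  have "(nrm K f)\<^sup>2 \<le> 2 * (nrm K (\<lambda>z. s n z - f z))\<^sup>2 + 2 * B * (nrm (l2_sum H) h)\<^sup>2" for n
  proof -
    have "(nrm K f)\<^sup>2 \<le> 2 * (nrm K (s n))\<^sup>2 + 2 * (nrm K (\<lambda>z. s n z - f z))\<^sup>2"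
    proof -
      have eq: "(\<lambda>z. s n z + - (s n z - f z)) = f" by simp
      show ?thesis
        using hilbert_space_parallelogram[OF K s sf, of n n]
          zero_le_power2[of "nrm K (\<lambda>z. s n z + (s n z - f z))"]
        unfolding eq by linarith
    qed
    also have "(nrm K (s n))\<^sup>2 \<le> B * (\<Sum>i<n. (nrm H (h i))\<^sup>2)"
      unfolding s_def by (rule le) simp
    also have "\<dots> \<le> B * (nrm (l2_sum H) h)\<^sup>2"
      by (intro mult_left_mono sum_le_nrm_l2_sum h B0) simp
    finally show ?thesis by simp
  qed
  moreover have "(\<lambda>n. 2 * (nrm K (\<lambda>z. s n z - f z))\<^sup>2 + 2 * B * (nrm (l2_sum H) h)\<^sup>2)
      \<longlonglongrightarrow> 2 * 0\<^sup>2 + 2 * B * (nrm (l2_sum H) h)\<^sup>2"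
    by (intro tendsto_intros lim)
  ultimately have "(nrm K f)\<^sup>2 \<le> 2 * 0\<^sup>2 + 2 * B * (nrm (l2_sum H) h)\<^sup>2"
    by (intro LIMSEQ_le_const) auto
  then show "(nrm K (row_op \<Phi> h))\<^sup>2 \<le> 2 * B * (nrm (l2_sum H) h)\<^sup>2"
    by (simp add: row)
qed

text \<open>The cut-off changes no product, since \<open>g\<close> vanishes off the ball. The
  operator norm covers \<open>g\<close> of positive norm; a \<open>g\<close> of norm 0 is the zero
  function by definiteness, and both sides are 0.\<close>

lemma Mult_l2_column_bound:
  assumes \<omega>: "admissible_weight \<omega>" and \<omega>': "admissible_weight \<omega>'"
    and \<Phi>: "\<Phi> \<in> Mult_l2 (besov n \<omega>) (besov n \<omega>')"
    and A: "op_norm (besov n \<omega>) (l2_sum (besov n \<omega>')) (col_op \<Phi>) \<le> ennreal A" "0 \<le> A"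
    and F: "finite F"
  shows "column_bound n \<omega> \<omega>' A F (\<lambda>i z. \<Phi> i z * indicator Bd z)"
  unfolding column_bound_def
proof
  fix g assume g: "g \<in> carr (besov n \<omega>)"
  have col: "col_op \<Phi> g \<in> carr (l2_sum (besov n \<omega>'))"
    using \<Phi> g by (simp add: Mult_l2_def)
  have eq: "(\<lambda>z. \<Phi> i z * indicator Bd z * g z) = col_op \<Phi> g i" for i
    using g Hol_zero_outside[of g] by (auto simp: col_op_def fun_eq_iff indicator_def carr_besov_iff)
  have "(\<Sum>i\<in>F. (nrm (besov n \<omega>') (col_op \<Phi> g i))\<^sup>2) \<le> A\<^sup>2 * (nrm (besov n \<omega>) g)\<^sup>2"
  proof (cases "nrm (besov n \<omega>) g = 0")
    case True
    then have "col_op \<Phi> g i = (\<lambda>z. 0)" for i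
      using besov_eq_zero[OF \<omega> g] by (simp add: col_op_def)
    then show ?thesis
      by (simp add: True nrm_besov_power2[OF \<omega>'] radial_funpow_zero L2_norm_def)
  next
    case False
    then have "0 < nrm (besov n \<omega>) g"
      using nrm_besov_nonneg[OF \<omega>, of n g] by simp
    then have "(nrm (l2_sum (besov n \<omega>')) (col_op \<Phi> g))\<^sup>2 \<le> (A * nrm (besov n \<omega>) g)\<^sup>2"
      by (intro power_mono op_normD[OF A g] nrm_l2_sum_nonneg[OF col])
    then show ?thesis
      using sum_le_nrm_l2_sum[OF col F] by (simp add: power_mult_distrib)
  qed
  then show "(\<forall>i\<in>F. (\<lambda>z. \<Phi> i z * indicator Bd z * g z) \<in> carr (besov n \<omega>')) \<and>
      (\<Sum>i\<in>F. (nrm (besov n \<omega>') (\<lambda>z. \<Phi> i z * indicator Bd z * g z))\<^sup>2) \<le> A\<^sup>2 * (nrm (besov n \<omega>) g)\<^sup>2"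
    unfolding eq using col by (simp add: l2_sum_carr_iff)
qed

section \<open>Rows are bounded by columns\<close>

theorem theorem4p2:
  fixes H K :: "'d::finite bfun nspace"
  assumes "weighted_besov_space H" and "weighted_besov_space K"
    and "multiplier_inclusion_condition H K"
  shows "\<exists>c>0. \<forall>\<Phi>\<in>MC H K.
           (\<forall>h\<in>carr (l2_sum H). \<forall>z\<in>Bd. summable (\<lambda>n. \<Phi> n z * h n z)) \<and>
           bounded_op (l2_sum H) K (row_op \<Phi>) \<and>
           op_norm (l2_sum H) K (row_op \<Phi>) \<le> ennreal c * op_norm H (l2_sum K) (col_op \<Phi>)"
proof -
  have H: "hilbert_space_of_analytic_functions H" and K: "hilbert_space_of_analytic_functions K"
    using assms by (simp_all add: weighted_besov_space_def)
  obtain \<omega> \<omega>' :: "complex ^ 'd \<Rightarrow> real" and N where \<omega>: "admissible_weight \<omega>" and \<omega>': "admissible_weight \<omega>'"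
    and eqH: "equiv_spaces H (besov N \<omega>)" and eqK: "equiv_spaces K (besov N \<omega>')"
    and chain: "\<forall>n\<in>{1..N}.
           Mult_l2 (besov n \<omega>) (besov n \<omega>') \<subseteq> Mult_l2 (besov (n - 1) \<omega>) (besov (n - 1) \<omega>') \<and>
           (\<exists>c>0. \<forall>\<Phi>\<in>Mult_l2 (besov n \<omega>) (besov n \<omega>').
              op_norm (besov (n - 1) \<omega>) (l2_sum (besov (n - 1) \<omega>')) (col_op \<Phi>)
                \<le> ennreal c * op_norm (besov n \<omega>) (l2_sum (besov n \<omega>')) (col_op \<Phi>))"
    using assms(3) unfolding multiplier_inclusion_condition_def by (elim exE conjE)
  let ?X = "besov N \<omega>" and ?Y = "besov N \<omega>'"
  obtain a b where a: "0 < a" and b: "0 < b" and carrH: "carr H = carr ?X"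
    and eqvH: "\<And>x. x \<in> carr ?X \<Longrightarrow> a * nrm ?X x \<le> nrm H x \<and> nrm H x \<le> b * nrm ?X x"
    using eqH unfolding equiv_spaces_def by metis
  obtain a' b' where a': "0 < a'" and b': "0 < b'" and carrK: "carr K = carr ?Y"
    and eqvK: "\<And>x. x \<in> carr ?Y \<Longrightarrow> a' * nrm ?Y x \<le> nrm K x \<and> nrm K x \<le> b' * nrm ?Y x"
    using eqK unfolding equiv_spaces_def by metis
  obtain P where P0: "0 \<le> P"
    and P: "\<forall>n\<le>N. \<forall>\<Phi>\<in>Mult_l2 ?X ?Y. \<Phi> \<in> Mult_l2 (besov n \<omega>) (besov n \<omega>') \<and>
      op_norm (besov n \<omega>) (l2_sum (besov n \<omega>')) (col_op \<Phi>) \<le> ennreal P * op_norm ?X (l2_sum ?Y) (col_op \<Phi>)"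
    using multiplier_chain_bound[OF chain] by (elim exE conjE)
  obtain C where C0: "0 \<le> C"
    and C: "\<forall>A F \<phi> h. finite F \<longrightarrow> (\<forall>i\<in>F. \<phi> i \<in> Hol) \<longrightarrow> (\<forall>n\<le>N. column_bound n \<omega> \<omega>' A F \<phi>) \<longrightarrow>
      (\<forall>j\<in>F. h j \<in> carr ?X) \<longrightarrow>
      (\<lambda>z. \<Sum>i\<in>F. \<phi> i z * h i z) \<in> carr ?Y \<and>
      (nrm ?Y (\<lambda>z. \<Sum>i\<in>F. \<phi> i z * h i z))\<^sup>2 \<le> C * A\<^sup>2 * (\<Sum>j\<in>F. (nrm ?X (h j))\<^sup>2)"
    using finite_row_bound[OF \<omega> \<omega>', of N] by (elim exE conjE)
  \<comment> \<open>\<open>q\<close> bounds the columns in all orders: \<open>b / a'\<close> is the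
    price of replacing \<open>H\<close> and \<open>K\<close> by the Besov spaces, \<open>P\<close>
    that of descending to lower orders. In \<open>D\<close> the factors \<open>b'\<^sup>2\<close>
    and \<open>a\<^sup>2\<close> translate the finite row estimate back to \<open>K\<close> and
    \<open>H\<close>. The 2 in \<open>c\<close> comes from \<open>row_op_bound\<close>, the added 1
    makes \<open>c\<close> positive even if \<open>D = 0\<close>.\<close>
  define q where "q = P * (b / a')"
  have q0: "0 \<le> q" using P0 a' b by (simp add: q_def)
  define D where "D = b'\<^sup>2 * (C * q\<^sup>2) / a\<^sup>2"
  have D0: "0 \<le> D" using C0 by (simp add: D_def)
  define c where "c = sqrt (2 * D) + 1"
  have c: "0 < c" using D0 by (simp add: c_def add_nonneg_pos)
  have one: "indicator Bd \<in> carr ?X" by (rule indicator_in_besov[OF \<omega>])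
  show ?thesis
  proof (intro exI[of _ c] conjI ballI c)
    fix \<Phi> assume \<Phi>: "\<Phi> \<in> MC H K"
    \<comment> \<open>Boundedness of the column makes its norm finite, so passing to a real number
      loses nothing.\<close>
    define A where "A = enn2real (op_norm H (l2_sum K) (col_op \<Phi>))"
    have A0: "0 \<le> A" by (simp add: A_def)
    have A: "op_norm H (l2_sum K) (col_op \<Phi>) = ennreal A"
      using \<Phi> by (simp add: A_def MC_def bounded_op_def)
    have col: "col_op \<Phi> h \<in> carr (l2_sum K)" if "h \<in> carr ?X" for h
      using \<Phi> that by (auto simp: MC_def bounded_op_def carrH)
    have colY: "col_op \<Phi> h \<in> carr (l2_sum ?Y)" "nrm (l2_sum ?Y) (col_op \<Phi> h) \<le> (1 / a') * nrm (l2_sum K) (col_op \<Phi> h)"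
      if h: "h \<in> carr ?X" for h
    proof -
      have *: "col_op \<Phi> h n \<in> carr ?Y" "0 \<le> nrm ?Y (col_op \<Phi> h n)"
        "nrm ?Y (col_op \<Phi> h n) \<le> (1 / a') * nrm K (col_op \<Phi> h n)" for n
        using col[OF h] eqvK[of "col_op \<Phi> h n"] a' nrm_besov_nonneg[OF \<omega>']
        by (auto simp: l2_sum_carr_iff carrK field_simps)
      show "col_op \<Phi> h \<in> carr (l2_sum ?Y)" "nrm (l2_sum ?Y) (col_op \<Phi> h) \<le> (1 / a') * nrm (l2_sum K) (col_op \<Phi> h)"
        using l2_sum_mono[OF col[OF h] *] a' by auto
    qed
    have mult: "\<Phi> \<in> Mult_l2 ?X ?Y"
      unfolding Mult_l2_def
    proof (intro CollectI conjI ballI colY)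
      \<comment> \<open>Applied to the constant 1 the column returns the multipliers themselves;
        their norms in \<open>K\<close> are square summable, and evaluation at \<open>z\<close> is
        bounded on \<open>K\<close>.\<close>
      fix z :: "complex ^ 'd" assume z: "z \<in> Bd"
      obtain B where B: "\<forall>f\<in>carr K. cmod (f z) \<le> B * nrm K f"
        using K z unfolding hilbert_space_of_analytic_functions_def by blast
      have "summable (\<lambda>n. B\<^sup>2 * (nrm K (col_op \<Phi> (indicator Bd) n))\<^sup>2)"
        using col[OF one] by (simp add: l2_sum_carr_iff summable_mult)
      then show "summable (\<lambda>n. (cmod (\<Phi> n z))\<^sup>2)"
      proof (rule summable_comparison_test'[of _ 0])
        fix n
        have "cmod (col_op \<Phi> (indicator Bd) n z) \<le> B * nrm K (col_op \<Phi> (indicator Bd) n)"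
          using B col[OF one] by (simp add: l2_sum_carr_iff)
        then have "(cmod (\<Phi> n z))\<^sup>2 \<le> (B * nrm K (col_op \<Phi> (indicator Bd) n))\<^sup>2"
          using z by (intro power_mono) (auto simp: col_op_def)
        then show "norm ((cmod (\<Phi> n z))\<^sup>2) \<le> B\<^sup>2 * (nrm K (col_op \<Phi> (indicator Bd) n))\<^sup>2"
          by (simp add: power_mult_distrib)
      qed
    qed
    have opX: "op_norm ?X (l2_sum ?Y) (col_op \<Phi>) \<le> ennreal (b / a' * A)"
    proof (rule op_norm_leI)
      fix x assume x: "x \<in> carr ?X" and pos: "0 < nrm ?X x"
      then have "0 < nrm H x" using eqvH[OF x] a by (meson less_le_trans mult_pos_pos)
      then have "nrm (l2_sum K) (col_op \<Phi> x) \<le> A * nrm H x"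
        using op_normD[of H "l2_sum K" "col_op \<Phi>" A x] A A0 x carrH by simp
      also have "\<dots> \<le> A * (b * nrm ?X x)" using eqvH[OF x] A0 by (intro mult_left_mono) auto
      finally show "nrm (l2_sum ?Y) (col_op \<Phi> x) \<le> b / a' * A * nrm ?X x"
        using colY(2)[OF x] a' by (simp add: field_simps)
    qed (rule nrm_besov_nonneg[OF \<omega>])
    have column: "column_bound n \<omega> \<omega>' (q * A) F (\<lambda>i z. \<Phi> i z * indicator Bd z)" if "n \<le> N" "finite F" for n F
    proof (rule Mult_l2_column_bound[OF \<omega> \<omega>' _ _ _ that(2)])
      show "\<Phi> \<in> Mult_l2 (besov n \<omega>) (besov n \<omega>')" using P that mult by blast
      have "op_norm (besov n \<omega>) (l2_sum (besov n \<omega>')) (col_op \<Phi>) \<le> ennreal P * op_norm ?X (l2_sum ?Y) (col_op \<Phi>)"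
        using P that mult by blast
      also have "\<dots> \<le> ennreal P * ennreal (b / a' * A)" by (intro mult_left_mono opX) simp
      also have "\<dots> = ennreal (q * A)" using P0 by (simp add: q_def ennreal_mult'[symmetric] mult.assoc)
      finally show "op_norm (besov n \<omega>) (l2_sum (besov n \<omega>')) (col_op \<Phi>) \<le> ennreal (q * A)" .
    qed (use q0 A0 in simp)
    \<comment> \<open>The cut-off multiplier is its product with the constant 1, hence an element of
      \<open>K\<close>.\<close>
    have \<phi>: "(\<lambda>z. \<Phi> i z * indicator Bd z) \<in> Hol" for i
    proof -
      have "(\<lambda>z. \<Phi> i z * indicator Bd z) \<in> carr K"
        using \<Phi> one by (simp add: MC_def Mult_def carrH)
      then show ?thesis using K unfolding hilbert_space_of_analytic_functions_def by blast
    qed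
    \<comment> \<open>The constant \<open>D * A\<^sup>2\<close> does not depend on \<open>F\<close>,
      as the passage to the infinite row requires.\<close>
    have fin: "(\<lambda>z. \<Sum>i\<in>F. \<Phi> i z * h i z) \<in> carr K"
      "(nrm K (\<lambda>z. \<Sum>i\<in>F. \<Phi> i z * h i z))\<^sup>2 \<le> D * A\<^sup>2 * (\<Sum>i\<in>F. (nrm H (h i))\<^sup>2)"
      if F: "finite F" and h: "\<And>i. h i \<in> carr H" for F h
    proof -
      let ?u = "\<lambda>z. \<Sum>i\<in>F. \<Phi> i z * h i z"
      have hX: "h i \<in> carr ?X" for i using h carrH by simp
      have "\<Phi> i z * indicator Bd z * h i z = \<Phi> i z * h i z" for i z
        using hX[of i] Hol_zero_outside[of "h i" z] by (auto simp: indicator_def carr_besov_iff)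
      then have eq: "(\<lambda>z. \<Sum>i\<in>F. \<Phi> i z * indicator Bd z * h i z) = ?u" by (simp only:)
      have "(\<lambda>z. \<Sum>i\<in>F. \<Phi> i z * indicator Bd z * h i z) \<in> carr ?Y \<and>
          (nrm ?Y (\<lambda>z. \<Sum>i\<in>F. \<Phi> i z * indicator Bd z * h i z))\<^sup>2 \<le> C * (q * A)\<^sup>2 * (\<Sum>j\<in>F. (nrm ?X (h j))\<^sup>2)"
        by (rule C[rule_format]) (intro F \<phi> column hX | assumption)+
      note this[unfolded eq]
      then have u: "?u \<in> carr ?Y" and le: "(nrm ?Y ?u)\<^sup>2 \<le> C * (q * A)\<^sup>2 * (\<Sum>j\<in>F. (nrm ?X (h j))\<^sup>2)"
        by simp_all
      show uK: "?u \<in> carr K" using u carrK by simp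
      have "(nrm K ?u)\<^sup>2 \<le> (b' * nrm ?Y ?u)\<^sup>2"
        using eqvK[OF u] hilbert_space_nrm_nonneg[OF K uK] by (intro power_mono) auto
      also have "\<dots> \<le> b'\<^sup>2 * (C * (q * A)\<^sup>2 * (\<Sum>j\<in>F. (nrm ?X (h j))\<^sup>2))"
        unfolding power_mult_distrib[of b'] by (intro mult_left_mono le) simp
      also have "\<dots> \<le> b'\<^sup>2 * (C * (q * A)\<^sup>2 * (\<Sum>j\<in>F. (nrm H (h j) / a)\<^sup>2))"
      proof (intro mult_left_mono sum_mono power_mono)
        show "nrm ?X (h j) \<le> nrm H (h j) / a" for j
          using eqvH[OF hX[of j]] a by (simp add: field_simps)
      qed (use C0 nrm_besov_nonneg[OF \<omega>] in auto)
      also have "\<dots> = D * A\<^sup>2 * (\<Sum>j\<in>F. (nrm H (h j))\<^sup>2)"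
        by (simp add: D_def power_divide power_mult_distrib sum_divide_distrib[symmetric])
      finally show "(nrm K ?u)\<^sup>2 \<le> D * A\<^sup>2 * (\<Sum>i\<in>F. (nrm H (h i))\<^sup>2)" .
    qed
    have row: "\<forall>z\<in>Bd. summable (\<lambda>n. \<Phi> n z * h n z)" "row_op \<Phi> h \<in> carr K"
        "(nrm K (row_op \<Phi> h))\<^sup>2 \<le> 2 * (D * A\<^sup>2) * (nrm (l2_sum H) h)\<^sup>2"
      if "h \<in> carr (l2_sum H)" for h
    proof -
      have DA: "0 \<le> D * A\<^sup>2" using D0 by simp
      have hH: "h i \<in> carr H" for i using that by (simp add: l2_sum_carr_iff)
      note row_op_bound[OF H K DA that fin(1)[OF _ hH] fin(2)[OF _ hH]]
      then show "\<forall>z\<in>Bd. summable (\<lambda>n. \<Phi> n z * h n z)" "row_op \<Phi> h \<in> carr K"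
        "(nrm K (row_op \<Phi> h))\<^sup>2 \<le> 2 * (D * A\<^sup>2) * (nrm (l2_sum H) h)\<^sup>2" by blast+
    qed
    show "summable (\<lambda>n. \<Phi> n z * h n z)" if "h \<in> carr (l2_sum H)" "z \<in> Bd" for h z
      using row(1) that by blast
    have op: "op_norm (l2_sum H) K (row_op \<Phi>) \<le> ennreal (c * A)"
    proof (rule op_norm_leI)
      fix h assume h: "h \<in> carr (l2_sum H)"
      have n0: "0 \<le> nrm (l2_sum H) h" by (rule nrm_l2_sum_nonneg[OF h])
      have "(nrm K (row_op \<Phi> h))\<^sup>2 \<le> (sqrt (2 * D) * A * nrm (l2_sum H) h)\<^sup>2"
        using row(3)[OF h] D0 by (simp add: power_mult_distrib mult_ac)
      then have "nrm K (row_op \<Phi> h) \<le> sqrt (2 * D) * A * nrm (l2_sum H) h"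
        using D0 A0 n0 by (auto intro: power2_le_imp_le)
      also have "\<dots> \<le> c * A * nrm (l2_sum H) h"
        using A0 n0 by (intro mult_right_mono) (auto simp: c_def)
      finally show "nrm K (row_op \<Phi> h) \<le> c * A * nrm (l2_sum H) h" .
    qed (rule nrm_l2_sum_nonneg)
    then show "bounded_op (l2_sum H) K (row_op \<Phi>)"
      using row(2) by (auto simp: bounded_op_def intro: le_less_trans)
    show "op_norm (l2_sum H) K (row_op \<Phi>) \<le> ennreal c * op_norm H (l2_sum K) (col_op \<Phi>)"
      using op c by (simp add: A ennreal_mult')
  qed
qed

end
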